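(* Let $G=(V,E)$ be a connected and locally finite weighted graph with a measure $\sigma$ satisfying $\sigma(x)\ge\sigma_0>0$ for all $x\in V$ and some constant $\sigma_0$, and let $p>1$. Let $a,b:V\to[0,+\infty)$ be such that $\Omega=\{x\in V:a(x)=0\}$ is a nonempty connected finite subset of $V$, $a(x)\ge1$ for all $x\in V\setminus\Omega$, and $a(x)\to+\infty$ as $d(x)\to+\infty$. Suppose that $\psi:V\times[0,+\infty)\to\mathbb{R}$, with primitive $\Psi(x,s)=\int_0^s\psi(x,t)\,dt$, satisfies: (i) $\psi(x,0)=0$ for every $x\in V$, $\psi(x,s)$ is continuous in $s\in[0,+\infty)$, and for every $M>0$ there is a constant $A_M$ such that $\psi(x,s)\le A_M$ for all $(x,s)\in V\times[0,M]$; (ii) there is a constant $\alpha>p$ such that $0<\alpha\Psi(x,s)\le s\psi(x,s)$ for all $s>0$ and $x\in V$; (iii) $\limsup_{s\to0+}\psi(x,s)/s^{p-1}<\lambda_{a,b}$ uniformly in $x\in V$; (iv) for every $x\in V$, $\psi(x,s)/s^{p-1}$ is strictly increasing in $s>0$. Let $\theta_k\ge1$ with $\theta_k\to+\infty$ as $k\to\infty$, and let $\{u_k\}\subset\mathcal{H}_{a,b}(V)$ be such that, for each $k$, $u_k$ is a positive ground state solution of $$-\Delta_pu+(\theta_ka+b)|u|^{p-2}u=\psi(x,u^+)\quad\text{in }V.$$ Then, up to a subsequence, $\{u_k\}$ converges in $W^{1,p}(V)$ to some $u_0$ with $u_0\equiv0$ on $V\setminus\Omega$, and the restriction of $u_0$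 to $\Omega$ is a positive ground state solution of the Dirichlet problem $$-\Delta_pu+b|u|^{p-2}u=\psi(x,u^+)\ \text{ in }\Omega,\qquad u=0\ \text{ on }\partial\Omega.$$
   Context: $G=(V,E)$ is a graph with vertex set $V$ and edge set $E$; $y\sim x$ means $xy\in E$; locally finite means every vertex has finitely many neighbours. Each edge has a weight $w_{xy}=w_{yx}>0$. $d(x)=dist(x,O)$ is the graph distance from $x$ to a fixed vertex $O\in V$. $\partial\Omega=\{y\notin\Omega:\exists x\in\Omega,\ xy\in E\}$ and $\overline\Omega=\Omega\cup\partial\Omega$. For $u:V\to\mathbb{R}$, $u^+=\max\{u,0\}$; $\int_A u\,d\sigma=\sum_{x\in A}\sigma(x)u(x)$ for $A\subset V$; $\|u\|_p=(\int_V|u|^pd\sigma)^{1/p}$. Gradient length: $|\nabla u|(x)=\big(\frac{1}{2\sigma(x)}\sum_{y\sim x}w_{xy}(u(y)-u(x))^2\big)^{1/2}$. $p$-Laplacian: $\Delta_pu(x)=\frac{1}{\sigma(x)}\sum_{y\sim x}\frac{|\nabla u|^{p-2}(x)+|\nabla u|^{p-2}(y)}{2}w_{xy}(u(y)-u(x))$. When $1<p<2$, terms with $u(y)=u(x)$ are read as $0$, and $|u|^{p-2}u$ is read as $0$ where $u=0$. $C_c(V)$ is the set of finitely supported functions on $V$. $W^{1,p}(V)$ is the space of $u:V\to\mathbb{R}$ with finite norm $\|u\|_{W^{1,p}(V)}=(\int_V(|\nabla u|^p+|u|^p)d\sigma)^{1/p}$. $\mathcal{H}_{a,b}(V)$ is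 the completion of $C_c(V)$ under $\|u\|_{\mathcal{H}_{a,b}}=(\int_V(|\nabla u|^p+(a+b)|u|^p)d\sigma)^{1/p}$, and $\lambda_{a,b}=\inf_{u\in\mathcal{H}_{a,b}(V),\,u\not\equiv0}\|u\|_{\mathcal{H}_{a,b}}^p/\|u\|_p^p$. In (iii), "uniformly" means there are $\tau<\lambda_{a,b}$ and $\delta>0$ with $\psi(x,s)\le\tau s^{p-1}$ for all $x\in V$, $0<s<\delta$. Problem on $V$: $\mathcal{H}_k(V)$ is the completion of $C_c(V)$ under $\|u\|_{\mathcal{H}_k}=(\int_V(|\nabla u|^p+(\theta_ka+b)|u|^p)d\sigma)^{1/p}$ (equal to $\mathcal{H}_{a,b}(V)$ with an equivalent norm); $J_k(u)=\frac1p\|u\|_{\mathcal{H}_k}^p-\int_V\Psi(x,u^+)d\sigma$; $\mathcal{N}_k=\{u\in\mathcal{H}_k(V)\setminus\{0\}:\|u\|_{\mathcal{H}_k}^p=\int_V\psi(x,u^+)u^+d\sigma\}$; $m_k=\inf_{\mathcal{N}_k}J_k$. A positive ground state solution is a function $u\in\mathcal{N}_k$ with $J_k(u)=m_k$, $u>0$ on $V$, solving the equation at every $x\in V$. Problem on $\Omega$: $W_0^{1,p}(\Omega)$ is the space of functions on $V$ vanishing on $V\setminus\Omega$, with norm $\|u\|_\Omega=(\int_{\overline\Omega}|\nabla u|^pd\sigma+\int_\Omega b|u|^pd\sigma)^{1/p}$; functions on $\Omega$ are extended by $0$ to $V$. $J_\Omega(u)=\frac1p\|u\|_\Omega^p-\int_\Omega\Psi(x,u^+)d\sigma$;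 $\mathcal{N}_\Omega=\{u\in W_0^{1,p}(\Omega)\setminus\{0\}:\|u\|_\Omega^p=\int_\Omega\psi(x,u^+)u^+d\sigma\}$; $m_\Omega=\inf_{\mathcal{N}_\Omega}J_\Omega$. A positive ground state solution of the Dirichlet problem is $u\in\mathcal{N}_\Omega$ with $J_\Omega(u)=m_\Omega$, $u>0$ on $\Omega$, solving the equation at every $x\in\Omega$. *)

theory Defs
  imports "HOL-Analysis.Analysis"
begin

(*
  The vertex set is the whole type 'v. E is the adjacency relation (x ~ y iff (x, y) is in E),
  w the edge weights (only their values on E matter) and \<sigma> the vertex measure.
  Loops are harmless: they contribute 0 to the gradient and to the p-Laplacian.

  Powers: 0 powr r = 0 in HOL for every r, including r = 0 and r < 0. In the expressions
  |grad u|^(p-2) (u y - u x) and |u|^(p-2) u the base vanishes only where the remaining factor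
  vanishes too, so this is exactly the usual convention (also for p = 2).
*)

definition graph_connected_on :: "'v set \<Rightarrow> 'v rel \<Rightarrow> bool" where
  "graph_connected_on A E \<longleftrightarrow> (\<forall>x\<in>A. \<forall>y\<in>A. (x, y) \<in> (Restr E A)\<^sup>*)"

definition graph_dist :: "'v rel \<Rightarrow> 'v \<Rightarrow> 'v \<Rightarrow> nat" where
  "graph_dist E x y = (LEAST n. (x, y) \<in> E ^^ n)"

definition vboundary :: "'v rel \<Rightarrow> 'v set \<Rightarrow> 'v set" where
  "vboundary E A = {y. y \<notin> A \<and> (\<exists>x\<in>A. (x, y) \<in> E)}"

definition vclosure :: "'v rel \<Rightarrow> 'v set \<Rightarrow> 'v set" where
  "vclosure E A = A \<union> vboundary E A"

definition weighted_graph :: "'v rel \<Rightarrow> ('v \<Rightarrow> 'v \<Rightarrow> real) \<Rightarrow> bool" where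
  "weighted_graph E w \<longleftrightarrow>
     sym E \<and> (\<forall>x y. (x, y) \<in> E \<longrightarrow> w x y = w y x \<and> 0 < w x y)"

definition locally_finite :: "'v rel \<Rightarrow> bool" where
  "locally_finite E \<longleftrightarrow> (\<forall>x. finite {y. (x, y) \<in> E})"

(* For a non-summable integrand the value is the default 0; the function spaces below therefore
   require summability explicitly. *)
definition vintegral :: "('v \<Rightarrow> real) \<Rightarrow> 'v set \<Rightarrow> ('v \<Rightarrow> real) \<Rightarrow> real" where
  "vintegral \<sigma> A f = (\<Sum>\<^sub>\<infinity>x\<in>A. \<sigma> x * f x)"

definition vintegrable :: "('v \<Rightarrow> real) \<Rightarrow> 'v set \<Rightarrow> ('v \<Rightarrow> real) \<Rightarrow> bool" where
  "vintegrable \<sigma> A f \<longleftrightarrow> (\<lambda>x. \<sigma> x * f x) summable_on A"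

definition Lp_norm :: "('v \<Rightarrow> real) \<Rightarrow> real \<Rightarrow> ('v \<Rightarrow> real) \<Rightarrow> real" where
  "Lp_norm \<sigma> p u = vintegral \<sigma> UNIV (\<lambda>x. \<bar>u x\<bar> powr p) powr (1 / p)"

definition grad_len ::
  "'v rel \<Rightarrow> ('v \<Rightarrow> 'v \<Rightarrow> real) \<Rightarrow> ('v \<Rightarrow> real) \<Rightarrow> ('v \<Rightarrow> real) \<Rightarrow> 'v \<Rightarrow> real" where
  "grad_len E w \<sigma> u x =
     sqrt (1 / (2 * \<sigma> x) * (\<Sum>y\<in>{y. (x, y) \<in> E}. w x y * (u y - u x)\<^sup>2))"

definition p_laplacian ::
  "'v rel \<Rightarrow> ('v \<Rightarrow> 'v \<Rightarrow> real) \<Rightarrow> ('v \<Rightarrow> real) \<Rightarrow> real \<Rightarrow> ('v \<Rightarrow> real) \<Rightarrow> 'v \<Rightarrow> real" where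
  "p_laplacian E w \<sigma> p u x =
     1 / \<sigma> x * (\<Sum>y\<in>{y. (x, y) \<in> E}.
       (grad_len E w \<sigma> u x powr (p - 2) + grad_len E w \<sigma> u y powr (p - 2)) / 2
         * w x y * (u y - u x))"

definition C_c :: "('v \<Rightarrow> real) set" where
  "C_c = {u. finite {x. u x \<noteq> 0}}"

definition energy_density ::
  "'v rel \<Rightarrow> ('v \<Rightarrow> 'v \<Rightarrow> real) \<Rightarrow> ('v \<Rightarrow> real) \<Rightarrow> real \<Rightarrow> ('v \<Rightarrow> real) \<Rightarrow> ('v \<Rightarrow> real) \<Rightarrow> 'v \<Rightarrow> real" where
  "energy_density E w \<sigma> p c u x = grad_len E w \<sigma> u x powr p + c x * \<bar>u x\<bar> powr p"

(* The potential c is 1 for W^{1,p}(V), a + b for H_{a,b}(V) and theta_k a + b for H_k(V). *)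
definition energy_norm ::
  "'v rel \<Rightarrow> ('v \<Rightarrow> 'v \<Rightarrow> real) \<Rightarrow> ('v \<Rightarrow> real) \<Rightarrow> real \<Rightarrow> ('v \<Rightarrow> real) \<Rightarrow> ('v \<Rightarrow> real) \<Rightarrow> real" where
  "energy_norm E w \<sigma> p c u = vintegral \<sigma> UNIV (energy_density E w \<sigma> p c u) powr (1 / p)"

definition W1p :: "'v rel \<Rightarrow> ('v \<Rightarrow> 'v \<Rightarrow> real) \<Rightarrow> ('v \<Rightarrow> real) \<Rightarrow> real \<Rightarrow> ('v \<Rightarrow> real) set" where
  "W1p E w \<sigma> p = {u. vintegrable \<sigma> UNIV (energy_density E w \<sigma> p (\<lambda>_. 1) u)}"

definition W1p_norm ::
  "'v rel \<Rightarrow> ('v \<Rightarrow> 'v \<Rightarrow> real) \<Rightarrow> ('v \<Rightarrow> real) \<Rightarrow> real \<Rightarrow> ('v \<Rightarrow> real) \<Rightarrow> real" where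
  "W1p_norm E w \<sigma> p u = energy_norm E w \<sigma> p (\<lambda>_. 1) u"

definition W1p_converges ::
  "'v rel \<Rightarrow> ('v \<Rightarrow> 'v \<Rightarrow> real) \<Rightarrow> ('v \<Rightarrow> real) \<Rightarrow> real \<Rightarrow> (nat \<Rightarrow> 'v \<Rightarrow> real) \<Rightarrow> ('v \<Rightarrow> real) \<Rightarrow> bool" where
  "W1p_converges E w \<sigma> p u u0 \<longleftrightarrow>
     (\<forall>k. u k \<in> W1p E w \<sigma> p) \<and> u0 \<in> W1p E w \<sigma> p \<and>
     (\<lambda>k. W1p_norm E w \<sigma> p (\<lambda>x. u k x - u0 x)) \<longlonglongrightarrow> 0"

(* The completion of C_c(V), realised as a space of functions: the functions of finite norm
   that are norm limits of finitely supported ones. On a connected graph with \<sigma> bounded below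
   and c \<ge> 1 off a finite proper subset, the functions of finite norm form a complete space
   in which convergence implies pointwise convergence, so this closure is the completion. *)
definition energy_space ::
  "'v rel \<Rightarrow> ('v \<Rightarrow> 'v \<Rightarrow> real) \<Rightarrow> ('v \<Rightarrow> real) \<Rightarrow> real \<Rightarrow> ('v \<Rightarrow> real) \<Rightarrow> ('v \<Rightarrow> real) set" where
  "energy_space E w \<sigma> p c =
     {u. vintegrable \<sigma> UNIV (energy_density E w \<sigma> p c u) \<and>
         (\<exists>\<phi> :: nat \<Rightarrow> 'v \<Rightarrow> real. (\<forall>n. \<phi> n \<in> C_c) \<and>
            (\<lambda>n. energy_norm E w \<sigma> p c (\<lambda>x. u x - \<phi> n x)) \<longlonglongrightarrow> 0)}"

definition lambda_ab ::
  "'v rel \<Rightarrow> ('v \<Rightarrow> 'v \<Rightarrow> real) \<Rightarrow> ('v \<Rightarrow> real) \<Rightarrow> real \<Rightarrow> ('v \<Rightarrow> real) \<Rightarrow> ('v \<Rightarrow> real) \<Rightarrow> real" where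
  "lambda_ab E w \<sigma> p a b =
     (INF u \<in> energy_space E w \<sigma> p (\<lambda>x. a x + b x) - {\<lambda>_. 0}.
        energy_norm E w \<sigma> p (\<lambda>x. a x + b x) u powr p / Lp_norm \<sigma> p u powr p)"

(* Only the values of psi on [0, \<infinity>) are used. *)
definition Primitive :: "('v \<Rightarrow> real \<Rightarrow> real) \<Rightarrow> 'v \<Rightarrow> real \<Rightarrow> real" where
  "Primitive \<psi> x s = integral {0..s} (\<psi> x)"

abbreviation pos_part :: "real \<Rightarrow> real" where
  "pos_part r \<equiv> max r 0"

(* The problem -Delta_p u + c |u|^(p-2) u = psi(x, u^+) on V; the problem with index k
   is the case c = theta_k a + b. *)

definition J_V ::
  "'v rel \<Rightarrow> ('v \<Rightarrow> 'v \<Rightarrow> real) \<Rightarrow> ('v \<Rightarrow> real) \<Rightarrow> real \<Rightarrow> ('v \<Rightarrow> real) \<Rightarrow>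
   ('v \<Rightarrow> real \<Rightarrow> real) \<Rightarrow> ('v \<Rightarrow> real) \<Rightarrow> real" where
  "J_V E w \<sigma> p c \<psi> u =
     1 / p * energy_norm E w \<sigma> p c u powr p
       - vintegral \<sigma> UNIV (\<lambda>x. Primitive \<psi> x (pos_part (u x)))"

definition Nehari_V ::
  "'v rel \<Rightarrow> ('v \<Rightarrow> 'v \<Rightarrow> real) \<Rightarrow> ('v \<Rightarrow> real) \<Rightarrow> real \<Rightarrow> ('v \<Rightarrow> real) \<Rightarrow>
   ('v \<Rightarrow> real \<Rightarrow> real) \<Rightarrow> ('v \<Rightarrow> real) set" where
  "Nehari_V E w \<sigma> p c \<psi> =
     {u \<in> energy_space E w \<sigma> p c - {\<lambda>_. 0}.
        energy_norm E w \<sigma> p c u powr p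
          = vintegral \<sigma> UNIV (\<lambda>x. \<psi> x (pos_part (u x)) * pos_part (u x))}"

definition ground_level_V ::
  "'v rel \<Rightarrow> ('v \<Rightarrow> 'v \<Rightarrow> real) \<Rightarrow> ('v \<Rightarrow> real) \<Rightarrow> real \<Rightarrow> ('v \<Rightarrow> real) \<Rightarrow>
   ('v \<Rightarrow> real \<Rightarrow> real) \<Rightarrow> real" where
  "ground_level_V E w \<sigma> p c \<psi> = (INF u \<in> Nehari_V E w \<sigma> p c \<psi>. J_V E w \<sigma> p c \<psi> u)"

definition positive_ground_state_V ::
  "'v rel \<Rightarrow> ('v \<Rightarrow> 'v \<Rightarrow> real) \<Rightarrow> ('v \<Rightarrow> real) \<Rightarrow> real \<Rightarrow> ('v \<Rightarrow> real) \<Rightarrow>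
   ('v \<Rightarrow> real \<Rightarrow> real) \<Rightarrow> ('v \<Rightarrow> real) \<Rightarrow> bool" where
  "positive_ground_state_V E w \<sigma> p c \<psi> u \<longleftrightarrow>
     u \<in> Nehari_V E w \<sigma> p c \<psi> \<and>
     J_V E w \<sigma> p c \<psi> u = ground_level_V E w \<sigma> p c \<psi> \<and>
     (\<forall>x. 0 < u x) \<and>
     (\<forall>x. - p_laplacian E w \<sigma> p u x + c x * (\<bar>u x\<bar> powr (p - 2) * u x)
            = \<psi> x (pos_part (u x)))"

(* The Dirichlet problem on A. Functions on A are identified with their extensions by 0. *)

definition W01p :: "'v set \<Rightarrow> ('v \<Rightarrow> real) set" where
  "W01p A = {u. \<forall>x. x \<notin> A \<longrightarrow> u x = 0}"

definition Dirichlet_norm ::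
  "'v rel \<Rightarrow> ('v \<Rightarrow> 'v \<Rightarrow> real) \<Rightarrow> ('v \<Rightarrow> real) \<Rightarrow> real \<Rightarrow> ('v \<Rightarrow> real) \<Rightarrow> 'v set \<Rightarrow>
   ('v \<Rightarrow> real) \<Rightarrow> real" where
  "Dirichlet_norm E w \<sigma> p b A u =
     (vintegral \<sigma> (vclosure E A) (\<lambda>x. grad_len E w \<sigma> u x powr p)
        + vintegral \<sigma> A (\<lambda>x. b x * \<bar>u x\<bar> powr p)) powr (1 / p)"

definition J_Dirichlet ::
  "'v rel \<Rightarrow> ('v \<Rightarrow> 'v \<Rightarrow> real) \<Rightarrow> ('v \<Rightarrow> real) \<Rightarrow> real \<Rightarrow> ('v \<Rightarrow> real) \<Rightarrow> 'v set \<Rightarrow>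
   ('v \<Rightarrow> real \<Rightarrow> real) \<Rightarrow> ('v \<Rightarrow> real) \<Rightarrow> real" where
  "J_Dirichlet E w \<sigma> p b A \<psi> u =
     1 / p * Dirichlet_norm E w \<sigma> p b A u powr p
       - vintegral \<sigma> A (\<lambda>x. Primitive \<psi> x (pos_part (u x)))"

definition Nehari_Dirichlet ::
  "'v rel \<Rightarrow> ('v \<Rightarrow> 'v \<Rightarrow> real) \<Rightarrow> ('v \<Rightarrow> real) \<Rightarrow> real \<Rightarrow> ('v \<Rightarrow> real) \<Rightarrow> 'v set \<Rightarrow>
   ('v \<Rightarrow> real \<Rightarrow> real) \<Rightarrow> ('v \<Rightarrow> real) set" where
  "Nehari_Dirichlet E w \<sigma> p b A \<psi> =
     {u \<in> W01p A - {\<lambda>_. 0}.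
        Dirichlet_norm E w \<sigma> p b A u powr p
          = vintegral \<sigma> A (\<lambda>x. \<psi> x (pos_part (u x)) * pos_part (u x))}"

definition ground_level_Dirichlet ::
  "'v rel \<Rightarrow> ('v \<Rightarrow> 'v \<Rightarrow> real) \<Rightarrow> ('v \<Rightarrow> real) \<Rightarrow> real \<Rightarrow> ('v \<Rightarrow> real) \<Rightarrow> 'v set \<Rightarrow>
   ('v \<Rightarrow> real \<Rightarrow> real) \<Rightarrow> real" where
  "ground_level_Dirichlet E w \<sigma> p b A \<psi> =
     (INF u \<in> Nehari_Dirichlet E w \<sigma> p b A \<psi>. J_Dirichlet E w \<sigma> p b A \<psi> u)"

definition positive_ground_state_Dirichlet ::
  "'v rel \<Rightarrow> ('v \<Rightarrow> 'v \<Rightarrow> real) \<Rightarrow> ('v \<Rightarrow> real) \<Rightarrow> real \<Rightarrow> ('v \<Rightarrow> real) \<Rightarrow> 'v set \<Rightarrow>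
   ('v \<Rightarrow> real \<Rightarrow> real) \<Rightarrow> ('v \<Rightarrow> real) \<Rightarrow> bool" where
  "positive_ground_state_Dirichlet E w \<sigma> p b A \<psi> u \<longleftrightarrow>
     u \<in> Nehari_Dirichlet E w \<sigma> p b A \<psi> \<and>
     J_Dirichlet E w \<sigma> p b A \<psi> u = ground_level_Dirichlet E w \<sigma> p b A \<psi> \<and>
     (\<forall>x\<in>A. 0 < u x) \<and>
     (\<forall>x\<in>A. - p_laplacian E w \<sigma> p u x + b x * (\<bar>u x\<bar> powr (p - 2) * u x)
              = \<psi> x (pos_part (u x))) \<and>
     (\<forall>x\<in>vboundary E A. u x = 0)"

end

theory Submission
  imports Defs
begin

text \<open>
The proof compares the problems on \<open>V\<close> with the Dirichlet problem on the finite well \<open>\<Omega>\<close>. Functions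
supported in \<open>\<Omega>\<close> do not feel the potential \<open>\<theta>\<^sub>k a\<close>, so the Dirichlet Nehari set is contained in every
Nehari set on \<open>V\<close>, with the same values of the functional (\<open>ground_level_V_le\<close>), and it is nonempty
(\<open>Nehari_Dirichlet_nonempty\<close>). Therefore \<open>J\<^sub>k(u\<^sub>k) \<le> J\<^sub>\<Omega>(f)\<close> for each of its elements \<open>f\<close>, and by the
Ambrosetti-Rabinowitz condition the energies of the \<open>u\<^sub>k\<close> are bounded (\<open>J_lower_bound\<close>,
\<open>energy_bounded\<close>).

Since the potential is at least \<open>\<theta>\<^sub>k\<close> off \<open>\<Omega>\<close>, the bounded energy forces the \<open>L\<^sup>p\<close> mass off \<open>\<Omega>\<close> to \<open>0\<close>, and a
lower bound for the vertex measure makes this decay uniform. On \<open>\<Omega>\<close> the values are bounded through the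
positive constant \<open>\<lambda>\<^sub>a\<^sub>,\<^sub>b\<close>. As \<open>\<Omega>\<close> is finite, a subsequence converges pointwise on \<open>V\<close> to a function \<open>v\<close> that
vanishes off \<open>\<Omega>\<close>, and the reaction integrals converge (\<open>reaction_tendsto\<close>).

The equation at a vertex involves finitely many values of the function, so \<open>v\<close> solves the Dirichlet
equation (\<open>v_equation\<close>). Testing it with \<open>v\<close> by Green's formula (\<open>Green_finite_support\<close>) shows that \<open>v\<close>
satisfies the Nehari constraint; that \<open>v\<close> is nonzero follows from \<open>\<tau> < \<lambda>\<^sub>a\<^sub>,\<^sub>b\<close> (\<open>v_nonzero\<close>). Now
\<open>J\<^sub>k(u\<^sub>k)\<close> tends to \<open>J\<^sub>\<Omega>(v)\<close>, so \<open>v\<close> minimizes (\<open>v_minimizes\<close>), and it is positive on the connected set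
\<open>\<Omega>\<close> by the strong maximum principle.

For \<open>W\<^sup>1\<^sup>,\<^sup>p\<close> convergence, the Nehari identities of \<open>u\<^sub>k\<close> and \<open>v\<close> show that the energy of \<open>u\<^sub>k\<close> tends to the
Dirichlet energy of \<open>v\<close>. The latter is reached already by the part of the energy on the finite closure of
\<open>\<Omega>\<close>, so no energy, and in particular no gradient, remains outside (\<open>W1p_tail_tendsto_0\<close>).\<close>

section \<open>Nonnegative series, powers and pointwise subsequences\<close>

lemma infsum_split_compl:
  fixes f :: "'v \<Rightarrow> real"
  assumes "f summable_on UNIV"
  shows "infsum f UNIV = infsum f A + infsum f (- A)"
proof -
  have "infsum f (A \<union> - A) = infsum f A + infsum f (- A)"
    by (rule infsum_Un_disjoint) (auto intro: summable_on_subset_banach[OF assms])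
  then show ?thesis by simp
qed

text \<open>Turns summability into smallness off a finite set: a function of finite \<open>L\<^sup>p\<close> norm on a space whose
points have measure at least \<open>\<sigma>\<^sub>0\<close> can only be large at finitely many vertices.\<close>

lemma finite_superlevel_of_summable:
  fixes f :: "'v \<Rightarrow> real"
  assumes sm: "f summable_on UNIV" and nn: "\<And>x. 0 \<le> f x" and e: "0 < \<epsilon>"
  shows "finite {x. \<epsilon> \<le> f x}"
proof -
  have bdd: "card G \<le> nat \<lfloor>infsum f UNIV / \<epsilon>\<rfloor>" if "G \<subseteq> {x. \<epsilon> \<le> f x}" "finite G" for G
  proof -
    have "of_nat (card G) * \<epsilon> \<le> sum f G"
      by (rule sum_bounded_below) (use that in auto)
    also have "\<dots> \<le> infsum f UNIV"
      by (rule finite_sum_le_infsum[OF sm]) (use that nn in auto)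
    finally have "real (card G) \<le> infsum f UNIV / \<epsilon>"
      using e by (simp add: field_simps)
    then show ?thesis by linarith
  qed
  show ?thesis
    using finite_if_finite_subsets_card_bdd[of "{x. \<epsilon> \<le> f x}" "nat \<lfloor>infsum f UNIV / \<epsilon>\<rfloor>"] bdd
    by simp
qed

text \<open>The expressions \<open>|\<nabla>u|\<^sup>p\<^sup>-\<^sup>2 (u(y) - u(x))\<close> and \<open>|u|\<^sup>p\<^sup>-\<^sup>2 u\<close> are continuous in the values of \<open>u\<close> even for
\<open>p < 2\<close>, where the power alone blows up at \<open>0\<close>: the second factor is bounded by the base, so the
product is of order \<open>g\<^sup>q\<^sup>+\<^sup>1\<close> with \<open>q + 1 > 0\<close>, which agrees at a vanishing base with the convention
\<open>0 powr q = 0\<close>.\<close>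

lemma tendsto_powr_times:
  fixes g d :: "nat \<Rightarrow> real"
  assumes g: "g \<longlonglongrightarrow> g0" and d: "d \<longlonglongrightarrow> d0" and nn: "\<And>k. 0 \<le> g k"
    and le: "\<And>k. \<bar>d k\<bar> \<le> C * g k" and q: "q > -1"
  shows "(\<lambda>k. g k powr q * d k) \<longlonglongrightarrow> g0 powr q * d0"
proof (cases "g0 = 0")
  case False
  then show ?thesis by (intro tendsto_intros g d) auto
next
  case True
  have lim: "(\<lambda>k. C * g k powr (q + 1)) \<longlonglongrightarrow> C * 0 powr (q + 1)"
    by (rule tendsto_mult[OF tendsto_const tendsto_powr'[OF g[unfolded True] tendsto_const]])
      (use nn q in auto)
  have "(\<lambda>k. g k powr q * d k) \<longlonglongrightarrow> 0"
  proof (rule Lim_null_comparison)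
    show "(\<lambda>k. C * g k powr (q + 1)) \<longlonglongrightarrow> 0" using lim by simp
    show "\<forall>\<^sub>F k in sequentially. norm (g k powr q * d k) \<le> C * g k powr (q + 1)"
    proof (intro always_eventually allI)
      fix k
      have "norm (g k powr q * d k) = g k powr q * \<bar>d k\<bar>" by (simp add: abs_mult)
      also have "\<dots> \<le> g k powr q * (C * g k)" by (intro mult_left_mono le) auto
      also have "\<dots> = C * g k powr (q + 1)"
        using nn[of k] by (cases "g k = 0") (auto simp: powr_add)
      finally show "norm (g k powr q * d k) \<le> C * g k powr (q + 1)" .
    qed
  qed
  then show ?thesis using True by simp
qed

lemma finite_pointwise_subsequence:
  fixes f :: "nat \<Rightarrow> 'v \<Rightarrow> real"
  assumes "finite A" and "\<And>k x. x \<in> A \<Longrightarrow> \<bar>f k x\<bar> \<le> B x"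
  shows "\<exists>r. strict_mono r \<and> (\<forall>x\<in>A. convergent (\<lambda>k. f (r k) x))"
  using assms
proof (induction A rule: finite_induct)
  case empty
  show ?case by (rule exI[of _ id]) (simp add: strict_mono_def)
next
  case (insert x A)
  then obtain r :: "nat \<Rightarrow> nat" where r: "strict_mono r" "\<forall>y\<in>A. convergent (\<lambda>k. f (r k) y)"
    by auto
  have "bounded (range (\<lambda>k. f (r k) x))"
    using insert.prems[of x] by (auto simp: bounded_iff)
  then obtain l s where s: "strict_mono (s :: nat \<Rightarrow> nat)" "((\<lambda>k. f (r k) x) \<circ> s) \<longlonglongrightarrow> l"
    using bounded_imp_convergent_subsequence by blast
  have "convergent (\<lambda>k. f (r (s k)) y)" if "y \<in> A" for y
    using r(2) that convergent_subseq_convergent[OF _ s(1), of "\<lambda>k. f (r k) y"]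
    by (auto simp: o_def)
  then show ?case
    using s r(1) by (intro exI[of _ "r \<circ> s"] conjI strict_mono_o) (auto simp: o_def convergent_def)
qed

section \<open>Gradient and p-Laplacian on a weighted graph\<close>

locale measured_graph =
  fixes E :: "'v rel" and w :: "'v \<Rightarrow> 'v \<Rightarrow> real" and \<sigma> :: "'v \<Rightarrow> real" and \<sigma>\<^sub>0 :: real
  assumes graph: "weighted_graph E w" and locfin: "locally_finite E"
    and \<sigma>\<^sub>0_pos: "0 < \<sigma>\<^sub>0" and \<sigma>_ge: "\<And>x. \<sigma>\<^sub>0 \<le> \<sigma> x"
begin

abbreviation nbrs :: "'v \<Rightarrow> 'v set" where "nbrs x \<equiv> {y. (x, y) \<in> E}"
abbreviation grad :: "('v \<Rightarrow> real) \<Rightarrow> 'v \<Rightarrow> real" where "grad \<equiv> grad_len E w \<sigma>"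

lemma \<sigma>_pos: "0 < \<sigma> x"
  using \<sigma>\<^sub>0_pos \<sigma>_ge[of x] by linarith

lemma E_sym: "(x, y) \<in> E \<Longrightarrow> (y, x) \<in> E"
  using graph by (auto simp: weighted_graph_def sym_def)

lemma w_sym: "(x, y) \<in> E \<Longrightarrow> w x y = w y x"
  and w_pos: "(x, y) \<in> E \<Longrightarrow> 0 < w x y"
  using graph by (auto simp: weighted_graph_def)

lemma finite_nbrs [simp]: "finite (nbrs x)"
  using locfin by (auto simp: locally_finite_def)

lemma finite_vclosure:
  assumes "finite A" shows "finite (vclosure E A)"
proof -
  have "vboundary E A \<subseteq> (\<Union>x\<in>A. nbrs x)" by (auto simp: vboundary_def)
  then show ?thesis using assms by (auto simp: vclosure_def intro: finite_subset)
qed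

lemma grad_sum_nonneg: "0 \<le> (\<Sum>y\<in>nbrs x. w x y * (u y - u x)\<^sup>2)"
  by (intro sum_nonneg mult_nonneg_nonneg) (auto intro: less_imp_le w_pos)

lemma grad_nonneg [simp]: "0 \<le> grad u x"
  using grad_sum_nonneg[of x u] \<sigma>_pos[of x] by (simp add: grad_len_def)

lemma grad_square: "\<sigma> x * (grad u x)\<^sup>2 = (\<Sum>y\<in>nbrs x. w x y * (u y - u x)\<^sup>2) / 2"
  using grad_sum_nonneg[of x u] \<sigma>_pos[of x] by (simp add: grad_len_def)

lemma grad_cong:
  assumes "u x = v x" "\<And>y. (x, y) \<in> E \<Longrightarrow> u y = v y"
  shows "grad u x = grad v x"
  using assms by (auto simp: grad_len_def intro!: arg_cong[where f = sqrt] sum.cong)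

lemma grad_zero [simp]: "grad (\<lambda>_. 0) x = 0"
  by (simp add: grad_len_def)

lemma grad_eq_0_off_vclosure:
  assumes "u \<in> W01p A" "x \<notin> vclosure E A"
  shows "grad u x = 0"
proof -
  have "grad u x = grad (\<lambda>_. 0) x"
    by (rule grad_cong)
      (use assms E_sym in \<open>auto simp: W01p_def vclosure_def vboundary_def\<close>)
  then show ?thesis by simp
qed

text \<open>One edge carries only part of the squared gradient length. This is the bound that makes the
\<open>p\<close>-Laplacian continuous under pointwise convergence.\<close>

lemma edge_diff_le_grad:
  assumes "(x, y) \<in> E"
  shows "\<bar>u y - u x\<bar> \<le> sqrt (2 * \<sigma> x / w x y) * grad u x"
proof -
  have "w x y * (u y - u x)\<^sup>2 \<le> (\<Sum>z\<in>nbrs x. w x z * (u z - u x)\<^sup>2)"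
    by (rule member_le_sum) (use assms in \<open>auto intro!: mult_nonneg_nonneg less_imp_le[OF w_pos]\<close>)
  then have "(u y - u x)\<^sup>2 \<le> (2 * \<sigma> x / w x y) * (grad u x)\<^sup>2"
    using grad_square[of x u] w_pos[OF assms] by (simp add: field_simps)
  then have "sqrt ((u y - u x)\<^sup>2) \<le> sqrt ((2 * \<sigma> x / w x y) * (grad u x)\<^sup>2)"
    by (rule real_sqrt_le_mono)
  also have "sqrt ((2 * \<sigma> x / w x y) * (grad u x)\<^sup>2) = sqrt (2 * \<sigma> x / w x y) * grad u x"
    by (subst real_sqrt_mult) simp
  finally show ?thesis by simp
qed

lemma grad_pos:
  assumes "(x, y) \<in> E" "u x \<noteq> u y"
  shows "0 < grad u x"
proof (rule ccontr)
  assume "\<not> 0 < grad u x"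
  then have "grad u x = 0" using grad_nonneg[of u x] by linarith
  then show False using edge_diff_le_grad[OF assms(1), of u] assms(2) by simp
qed

lemma tendsto_grad:
  assumes "\<And>z. (\<lambda>k. u k z) \<longlonglongrightarrow> v z"
  shows "(\<lambda>k. grad (u k) x) \<longlonglongrightarrow> grad v x"
  unfolding grad_len_def by (intro tendsto_intros assms)

text \<open>By local finiteness the \<open>p\<close>-Laplacian at a vertex depends on finitely many values, so pointwise
convergence is enough to pass to the limit in the equation.\<close>

lemma tendsto_p_laplacian:
  assumes p: "1 < p" and lim: "\<And>z. (\<lambda>k. u k z) \<longlonglongrightarrow> v z"
  shows "(\<lambda>k. p_laplacian E w \<sigma> p (u k) x) \<longlonglongrightarrow> p_laplacian E w \<sigma> p v x"
proof -
  have 1: "(\<lambda>k. grad (u k) x powr (p - 2) * (u k y - u k x))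
      \<longlonglongrightarrow> grad v x powr (p - 2) * (v y - v x)" if "(x, y) \<in> E" for x y
    by (rule tendsto_powr_times[where C = "sqrt (2 * \<sigma> x / w x y)"])
      (use p that edge_diff_le_grad in \<open>auto intro!: tendsto_intros tendsto_grad lim\<close>)
  have 2: "(\<lambda>k. (grad (u k) x powr (p - 2) + grad (u k) y powr (p - 2)) / 2 * w x y * (u k y - u k x))
      \<longlonglongrightarrow> (grad v x powr (p - 2) + grad v y powr (p - 2)) / 2 * w x y * (v y - v x)"
    if "(x, y) \<in> E" for y
  proof -
    \<comment> \<open>The gradient at each endpoint must multiply the difference seen from that endpoint, since only then does the edge bound control the product.\<close>
    have eq: "(grad f x powr (p - 2) + grad f y powr (p - 2)) / 2 * w x y * (f y - f x) =
        w x y / 2 * (grad f x powr (p - 2) * (f y - f x) - grad f y powr (p - 2) * (f x - f y))" for f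
      by (simp add: field_simps)
    show ?thesis unfolding eq[of v] eq[of "u k" for k] by (intro tendsto_intros 1[OF that] 1[OF E_sym[OF that]])
  qed
  show ?thesis unfolding p_laplacian_def by (intro tendsto_intros 2) auto
qed

text \<open>Summation by parts. All sums are moved to the finite closure \<open>K\<close> of the support, with the weights
extended by \<open>0\<close> to a symmetric matrix \<open>W\<close> on \<open>K \<times> K\<close>. Exchanging the two endpoints of an edge turns
\<open>v(x)(v(y) - v(x))\<close> into half of \<open>-(v(y) - v(x))\<^sup>2\<close> and lets the average of the two gradient powers be
replaced by the one at \<open>x\<close>, which together with the square gives \<open>|\<nabla>v|\<^sup>p\<close>.\<close>

lemma Green_finite_support:
  assumes p: "1 < p" and A: "finite A" and v: "v \<in> W01p A"
  shows "(\<Sum>x\<in>A. \<sigma> x * (v x * - p_laplacian E w \<sigma> p v x))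
       = (\<Sum>x\<in>vclosure E A. \<sigma> x * grad v x powr p)"
proof -
  define K where "K = vclosure E A"
  define g where "g x = grad v x powr (p - 2)" for x
  define W where "W x y = (if (x, y) \<in> E then w x y else 0)" for x y
  have K: "finite K" unfolding K_def by (rule finite_vclosure[OF A])
  have AK: "A \<subseteq> K" by (auto simp: K_def vclosure_def)
  have W_sym: "W x y = W y x" for x y using E_sym w_sym by (auto simp: W_def)
  have v0: "v x = 0" if "x \<notin> A" for x using v that by (auto simp: W01p_def)
  have nb: "y \<in> K" if "x \<in> A" "(x, y) \<in> E" for x y
    using that by (auto simp: K_def vclosure_def vboundary_def)
  have to_K: "(\<Sum>y\<in>nbrs x. w x y * f y) = (\<Sum>y\<in>K. W x y * f y)"
    if "\<And>y. (x, y) \<in> E \<Longrightarrow> y \<notin> K \<Longrightarrow> f y = 0" for x and f :: "'v \<Rightarrow> real"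
  proof -
    have "(\<Sum>y\<in>nbrs x. w x y * f y) = (\<Sum>y\<in>nbrs x \<union> K. W x y * f y)"
      by (rule sum.mono_neutral_cong_left) (use K in \<open>auto simp: W_def\<close>)
    also have "\<dots> = (\<Sum>y\<in>K. W x y * f y)"
      by (rule sum.mono_neutral_cong_right) (use K that in auto)
    finally show ?thesis .
  qed
  define S where "S = (\<Sum>x\<in>K. \<Sum>y\<in>K. W x y * (g x * (v y - v x)\<^sup>2))"
  have lap: "\<sigma> x * (v x * - p_laplacian E w \<sigma> p v x) =
      - (\<Sum>y\<in>K. W x y * ((g x + g y) / 2 * (v x * (v y - v x))))" if "x \<in> A" for x
  proof -
    have "\<sigma> x * (v x * - p_laplacian E w \<sigma> p v x) =
        - (\<Sum>y\<in>nbrs x. w x y * ((g x + g y) / 2 * (v x * (v y - v x))))"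
      using \<sigma>_pos[of x]
      by (simp add: p_laplacian_def g_def sum_distrib_left mult_ac)
    also have "(\<Sum>y\<in>nbrs x. w x y * ((g x + g y) / 2 * (v x * (v y - v x)))) =
        (\<Sum>y\<in>K. W x y * ((g x + g y) / 2 * (v x * (v y - v x))))"
      by (rule to_K) (use nb that in auto)
    finally show ?thesis .
  qed
  \<comment> \<open>\<open>T'\<close> is \<open>T\<close> with the endpoints of each edge exchanged; the two agree because \<open>W\<close> is symmetric, and their sum is minus a weighted sum of squares.\<close>
  define T where "T = (\<Sum>x\<in>K. \<Sum>y\<in>K. W x y * ((g x + g y) / 2 * (v x * (v y - v x))))"
  define T' where "T' = (\<Sum>x\<in>K. \<Sum>y\<in>K. W x y * ((g x + g y) / 2 * (v y * (v x - v y))))"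
  have "(\<Sum>x\<in>A. \<sigma> x * (v x * - p_laplacian E w \<sigma> p v x)) =
      (\<Sum>x\<in>A. - (\<Sum>y\<in>K. W x y * ((g x + g y) / 2 * (v x * (v y - v x)))))"
    by (rule sum.cong[OF refl lap])
  also have "\<dots> = - T"
    unfolding T_def sum_negf[symmetric]
    by (rule sum.mono_neutral_left) (use K AK v0 in auto)
  finally have lhs: "(\<Sum>x\<in>A. \<sigma> x * (v x * - p_laplacian E w \<sigma> p v x)) = - T" .
  have swap: "T = T'"
    unfolding T_def T'_def by (subst sum.swap) (simp add: W_sym add.commute)
  have S': "S = (\<Sum>x\<in>K. \<Sum>y\<in>K. W x y * (g y * (v y - v x)\<^sup>2))"
    unfolding S_def by (subst sum.swap) (simp add: W_sym power2_commute)
  have "T + T' = (\<Sum>x\<in>K. \<Sum>y\<in>K. - (W x y * (g x * (v y - v x)\<^sup>2) + W x y * (g y * (v y - v x)\<^sup>2)) / 2)"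
    unfolding T_def T'_def sum.distrib[symmetric]
    by (intro sum.cong refl) (simp add: field_simps power2_eq_square)
  also have "\<dots> = - (S + S) / 2"
    by (subst (2) S')
      (simp only: S_def sum_divide_distrib[symmetric] sum_negf sum.distrib)
  finally have T: "- T = S / 2" using swap by simp
  have "\<sigma> x * grad v x powr p = (\<Sum>y\<in>K. W x y * (g x * (v y - v x)\<^sup>2)) / 2" if "x \<in> K" for x
  proof -
    have "\<sigma> x * grad v x powr p = g x * (\<sigma> x * (grad v x)\<^sup>2)"
    proof (cases "grad v x = 0")
      case True then show ?thesis by simp
    next
      case False
      then have "0 < grad v x" using grad_nonneg[of v x] by linarith
      then have "grad v x powr p = grad v x powr (p - 2) * (grad v x)\<^sup>2"
        by (simp add: powr_diff powr_numeral)
      then show ?thesis by (simp add: g_def)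
    qed
    also have "\<dots> = (\<Sum>y\<in>nbrs x. w x y * (g x * (v y - v x)\<^sup>2)) / 2"
      by (simp add: grad_square sum_distrib_left mult_ac)
    also have "(\<Sum>y\<in>nbrs x. w x y * (g x * (v y - v x)\<^sup>2)) = (\<Sum>y\<in>K. W x y * (g x * (v y - v x)\<^sup>2))"
    proof (rule to_K)
      fix y assume "(x, y) \<in> E" "y \<notin> K"
      then have "x \<notin> A" "y \<notin> A" using nb AK by blast+
      then show "g x * (v y - v x)\<^sup>2 = 0" by (simp add: v0)
    qed
    finally show ?thesis .
  qed
  then have "(\<Sum>x\<in>K. \<sigma> x * grad v x powr p) = S / 2"
    by (simp add: S_def sum_divide_distrib)
  then show ?thesis using lhs T by (simp add: K_def)
qed

text \<open>At a zero of a nonnegative function every edge term of the \<open>p\<close>-Laplacian is nonnegative, and an edge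
to a positive neighbour contributes a strictly positive term: such an edge makes the gradient at the
zero positive, so the coefficient with power \<open>p - 2\<close> does not vanish. Hence a zero at which the \<open>p\<close>-Laplacian
vanishes spreads along edges inside a connected set.\<close>

lemma strong_maximum_principle:
  assumes conn: "graph_connected_on A E" and nn: "\<And>x. 0 \<le> v x"
    and lap: "\<And>x. x \<in> A \<Longrightarrow> v x = 0 \<Longrightarrow> p_laplacian E w \<sigma> p v x = 0"
    and z: "z \<in> A" "v z \<noteq> 0" and x: "x \<in> A"
  shows "0 < v x"
proof (rule ccontr)
  assume "\<not> 0 < v x"
  then have x0: "v x = 0" using nn[of x] by linarith
  have zero_spreads: "v y = 0" if "x \<in> A" "v x = 0" "(x, y) \<in> E" for x y
  proof (rule ccontr)
    assume "v y \<noteq> 0"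
    then have vy: "0 < v y" using nn[of y] by linarith
    let ?t = "\<lambda>y. (grad v x powr (p - 2) + grad v y powr (p - 2)) / 2 * w x y * (v y - v x)"
    have "0 < grad v x" by (rule grad_pos[OF that(3)]) (use that vy in auto)
    then have "0 < grad v x powr (p - 2) + grad v y powr (p - 2)"
      by (intro add_pos_nonneg) auto
    then have "0 < ?t y" using w_pos[OF that(3)] vy that(2) by simp
    moreover have "?t y \<le> sum ?t (nbrs x)"
      by (rule member_le_sum)
        (use that nn in \<open>auto intro!: mult_nonneg_nonneg add_nonneg_nonneg less_imp_le[OF w_pos]\<close>)
    moreover have "sum ?t (nbrs x) = 0"
      using lap[OF that(1,2)] \<sigma>_pos[of x] by (simp add: p_laplacian_def)
    ultimately show False by linarith
  qed
  have "(x, z) \<in> (Restr E A)\<^sup>*" using conn x z by (auto simp: graph_connected_on_def)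
  then have "v z = 0"
  proof (induction rule: rtrancl_induct)
    case base
    show ?case by (rule x0)
  next
    case (step y z)
    then show ?case using zero_spreads[of y z] by blast
  qed
  then show False using z by simp
qed

end

section \<open>The variational problem with a potential well\<close>

text \<open>The constants \<open>\<tau>\<close> and \<open>\<delta>\<close> witness that \<open>\<psi>(x,s)/s\<^sup>p\<^sup>-\<^sup>1\<close> stays below \<open>\<lambda>\<^sub>a\<^sub>,\<^sub>b\<close> near \<open>0\<close>, uniformly in \<open>x\<close>, and
\<open>\<alpha>\<close> is the exponent of the Ambrosetti-Rabinowitz condition.\<close>

locale nehari_problem = measured_graph E w \<sigma> \<sigma>\<^sub>0
  for E :: "'v rel" and w :: "'v \<Rightarrow> 'v \<Rightarrow> real" and \<sigma> :: "'v \<Rightarrow> real" and \<sigma>\<^sub>0 :: real +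
  fixes p :: real and a b :: "'v \<Rightarrow> real" and \<Omega> :: "'v set"
    and \<psi> :: "'v \<Rightarrow> real \<Rightarrow> real" and \<alpha> \<tau> \<delta> :: real
  assumes p: "1 < p"
    and a_nonneg: "\<And>x. 0 \<le> a x" and b_nonneg: "\<And>x. 0 \<le> b x"
    and a_zero: "\<And>x. x \<in> \<Omega> \<Longrightarrow> a x = 0" and a_ge_1: "\<And>x. x \<notin> \<Omega> \<Longrightarrow> 1 \<le> a x"
    and finite_\<Omega>: "finite \<Omega>" and \<Omega>_ne: "\<Omega> \<noteq> {}"
    and \<psi>_0: "\<And>x. \<psi> x 0 = 0" and \<psi>_cont: "\<And>x. continuous_on {0..} (\<psi> x)"
    and \<alpha>: "p < \<alpha>"
    and \<Psi>_pos: "\<And>x s. 0 < s \<Longrightarrow> 0 < \<alpha> * Primitive \<psi> x s"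
    and AR: "\<And>x s. 0 < s \<Longrightarrow> \<alpha> * Primitive \<psi> x s \<le> s * \<psi> x s"
    and \<tau>: "\<tau> < lambda_ab E w \<sigma> p a b" and \<delta>: "0 < \<delta>"
    and \<psi>_small: "\<And>x s. 0 < s \<Longrightarrow> s < \<delta> \<Longrightarrow> \<psi> x s \<le> \<tau> * s powr (p - 1)"
begin

abbreviation energy :: "('v \<Rightarrow> real) \<Rightarrow> ('v \<Rightarrow> real) \<Rightarrow> real" where
  "energy c u \<equiv> vintegral \<sigma> UNIV (energy_density E w \<sigma> p c u)"

abbreviation mass :: "('v \<Rightarrow> real) \<Rightarrow> 'v \<Rightarrow> real" where
  "mass u x \<equiv> \<sigma> x * \<bar>u x\<bar> powr p"

abbreviation \<psi>_term :: "('v \<Rightarrow> real) \<Rightarrow> 'v \<Rightarrow> real" where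
  "\<psi>_term u x \<equiv> \<sigma> x * (\<psi> x (pos_part (u x)) * pos_part (u x))"

abbreviation \<Psi>_term :: "('v \<Rightarrow> real) \<Rightarrow> 'v \<Rightarrow> real" where
  "\<Psi>_term u x \<equiv> \<sigma> x * Primitive \<psi> x (pos_part (u x))"

text \<open>The class of potentials whose energy controls the \<open>L\<^sup>p\<close> norm off the finite well. It contains
\<open>t a + b\<close> for every \<open>t \<ge> 1\<close>, so the results below hold for \<open>\<H>\<^sub>a\<^sub>,\<^sub>b(V)\<close> and all \<open>\<H>\<^sub>k(V)\<close> at once.\<close>

definition admissible :: "('v \<Rightarrow> real) \<Rightarrow> bool" where
  "admissible c \<longleftrightarrow> (\<forall>x. 0 \<le> c x) \<and> (\<forall>x. x \<notin> \<Omega> \<longrightarrow> 1 \<le> c x)"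

lemma admissible_deep_well: "1 \<le> t \<Longrightarrow> admissible (\<lambda>x. t * a x + b x)"
  unfolding admissible_def
proof (intro conjI allI impI)
  fix x assume t: "1 \<le> t"
  show "0 \<le> t * a x + b x" using t a_nonneg[of x] b_nonneg[of x] by simp
  assume "x \<notin> \<Omega>"
  then have "1 * 1 \<le> t * a x" using t a_ge_1 by (intro mult_mono) auto
  then show "1 \<le> t * a x + b x" using b_nonneg[of x] by simp
qed

lemma admissible_nonneg: "admissible c \<Longrightarrow> 0 \<le> c x"
  by (simp add: admissible_def)

lemma energy_density_nonneg: "0 \<le> c x \<Longrightarrow> 0 \<le> energy_density E w \<sigma> p c u x"
  by (simp add: energy_density_def)

lemma energy_nonneg: "(\<And>x. 0 \<le> c x) \<Longrightarrow> 0 \<le> energy c u"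
  unfolding vintegral_def
  by (intro infsum_nonneg mult_nonneg_nonneg energy_density_nonneg) (auto intro: less_imp_le \<sigma>_pos)

lemma powr_inverse_exponent: "0 \<le> (r::real) \<Longrightarrow> (r powr (1 / p)) powr p = r"
  using p by (simp add: powr_powr)

lemma energy_norm_powr: "(\<And>x. 0 \<le> c x) \<Longrightarrow> energy_norm E w \<sigma> p c u powr p = energy c u"
  unfolding energy_norm_def by (intro powr_inverse_exponent energy_nonneg) auto

lemma mass_summable:
  assumes c: "admissible c" and u: "vintegrable \<sigma> UNIV (energy_density E w \<sigma> p c u)"
  shows "mass u summable_on UNIV"
proof -
  let ?e = "\<lambda>x. \<sigma> x * energy_density E w \<sigma> p c u x"
  have "?e summable_on - \<Omega>"
    using u unfolding vintegrable_def by (rule summable_on_subset_banach) simp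
  then have "mass u summable_on - \<Omega>"
  proof (rule summable_on_comparison_test)
    fix x assume x: "x \<in> - \<Omega>"
    then have "1 * \<bar>u x\<bar> powr p \<le> c x * \<bar>u x\<bar> powr p"
      using c by (intro mult_right_mono) (auto simp: admissible_def)
    then show "mass u x \<le> ?e x"
      using less_imp_le[OF \<sigma>_pos[of x]]
      by (intro mult_left_mono) (auto simp: energy_density_def add_increasing)
    show "0 \<le> mass u x" using less_imp_le[OF \<sigma>_pos[of x]] by simp
  qed
  then have "mass u summable_on (\<Omega> \<union> - \<Omega>)"
    by (intro summable_on_union) (simp_all add: finite_\<Omega>)
  then show ?thesis by simp
qed

lemma Lp_norm_powr: "Lp_norm \<sigma> p u powr p = infsum (mass u) UNIV"
  unfolding Lp_norm_def
  by (subst powr_inverse_exponent)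
    (auto simp: vintegral_def intro!: infsum_nonneg mult_nonneg_nonneg less_imp_le[OF \<sigma>_pos])

text \<open>The Rayleigh quotient bound, in a form free of division. Inside the well, where the potential may
vanish, it takes the place of a Poincare inequality.\<close>

lemma lambda_times_mass_le_energy:
  assumes u: "u \<in> energy_space E w \<sigma> p (\<lambda>x. a x + b x)" "u \<noteq> (\<lambda>_. 0)"
  shows "lambda_ab E w \<sigma> p a b * infsum (mass u) UNIV \<le> energy (\<lambda>x. a x + b x) u"
proof -
  let ?c = "\<lambda>x. a x + b x"
  have c: "0 \<le> ?c x" for x using a_nonneg b_nonneg by simp
  have "lambda_ab E w \<sigma> p a b \<le> energy_norm E w \<sigma> p ?c u powr p / Lp_norm \<sigma> p u powr p"
    unfolding lambda_ab_def
    by (rule cINF_lower) (use u in \<open>auto intro!: bdd_belowI[of _ 0]\<close>)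
  then have le: "lambda_ab E w \<sigma> p a b \<le> energy ?c u / infsum (mass u) UNIV"
    by (simp add: energy_norm_powr c Lp_norm_powr)
  have "0 \<le> infsum (mass u) UNIV"
    by (intro infsum_nonneg mult_nonneg_nonneg) (auto intro: less_imp_le \<sigma>_pos)
  then consider "infsum (mass u) UNIV = 0" | "0 < infsum (mass u) UNIV" by linarith
  then show ?thesis
  proof cases
    case 1 then show ?thesis using energy_nonneg[of ?c u] c by simp
  next
    case 2 then show ?thesis using le by (simp add: field_simps)
  qed
qed

lemma \<psi>_pos: "0 < s \<Longrightarrow> 0 < \<psi> x s"
  using \<Psi>_pos[of s x] AR[of s x] by (smt (verit) zero_less_mult_iff)

text \<open>Since \<open>\<psi>\<close> is positive, the smallness condition forces \<open>0 < \<tau> < \<lambda>\<^sub>a\<^sub>,\<^sub>b\<close>; in particular \<open>\<lambda>\<^sub>a\<^sub>,\<^sub>b\<close> is positive.\<close>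

lemma \<tau>_pos: "0 < \<tau>"
proof -
  have "0 < \<tau> * (\<delta> / 2) powr (p - 1)"
    using \<psi>_pos[of "\<delta> / 2" undefined] \<psi>_small[of "\<delta> / 2" undefined] \<delta> by simp
  then show ?thesis using \<delta> by (simp add: zero_less_mult_iff)
qed

lemma \<alpha>_pos: "0 < \<alpha>"
  using p \<alpha> by linarith

lemma Primitive_0 [simp]: "Primitive \<psi> x 0 = 0"
  by (simp add: Primitive_def)

lemma \<Psi>_term_nonneg: "0 \<le> \<Psi>_term u x"
proof -
  have "0 \<le> Primitive \<psi> x s" if "0 \<le> s" for s
    using \<Psi>_pos[of s x] \<alpha>_pos that by (cases "s = 0") (auto simp: zero_less_mult_iff)
  then show ?thesis using less_imp_le[OF \<sigma>_pos] by simp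
qed

lemma \<Psi>_term_le: "\<Psi>_term u x \<le> \<psi>_term u x / \<alpha>"
proof -
  have "Primitive \<psi> x s \<le> \<psi> x s * s / \<alpha>" if "0 \<le> s" for s
    using AR[of s x] \<alpha>_pos that by (cases "s = 0") (auto simp: field_simps)
  then have "\<Psi>_term u x \<le> \<sigma> x * (\<psi> x (pos_part (u x)) * pos_part (u x) / \<alpha>)"
    by (intro mult_left_mono) (auto intro: less_imp_le \<sigma>_pos)
  then show ?thesis by simp
qed

lemma \<psi>_term_nonneg: "0 \<le> \<psi>_term u x"
  using \<Psi>_term_nonneg[of x u] \<Psi>_term_le[of x u] \<alpha>_pos by (smt (verit) divide_neg_pos)

lemma \<psi>_term_le_mass:
  assumes "u x < \<delta>"
  shows "\<psi>_term u x \<le> \<tau> * mass u x"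
proof (cases "0 < u x")
  case True
  have "\<psi> x (u x) * u x \<le> (\<tau> * u x powr (p - 1)) * u x"
    using \<psi>_small[OF True assms] True by (intro mult_right_mono) auto
  also have "\<dots> = \<tau> * u x powr p"
    using True by (simp add: powr_diff)
  finally have "\<sigma> x * (\<psi> x (u x) * u x) \<le> \<sigma> x * (\<tau> * u x powr p)"
    by (intro mult_left_mono less_imp_le[OF \<sigma>_pos])
  then show ?thesis using True by (simp add: max_def mult_ac)
next
  case False
  then have "pos_part (u x) = 0" by simp
  then show ?thesis using \<tau>_pos \<sigma>_pos[of x] by simp
qed

text \<open>A function of finite mass exceeds \<open>\<delta>\<close> at finitely many vertices only, and elsewhere the reaction
term is dominated by \<open>\<tau>\<close> times the mass. Thus the integrals over \<open>V\<close> in the functional and in the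
Nehari constraint have their intended meaning and not the default value \<open>0\<close>.\<close>

lemma \<psi>_term_summable:
  assumes m: "mass u summable_on UNIV"
  shows "\<psi>_term u summable_on UNIV"
proof -
  define B where "B = {x. \<sigma>\<^sub>0 * \<delta> powr p \<le> mass u x}"
  have B: "finite B"
    unfolding B_def
    by (rule finite_superlevel_of_summable[OF m])
      (use \<sigma>\<^sub>0_pos \<delta> less_imp_le[OF \<sigma>_pos] in auto)
  have lt: "u x < \<delta>" if "x \<notin> B" for x
  proof (rule ccontr)
    assume "\<not> u x < \<delta>"
    then have "\<sigma>\<^sub>0 * \<delta> powr p \<le> mass u x"
      using \<sigma>\<^sub>0_pos \<sigma>_ge[of x] \<delta> p by (intro mult_mono powr_mono2) auto
    then show False using that by (simp add: B_def)
  qed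
  have "(\<lambda>x. \<tau> * mass u x) summable_on - B"
    by (intro summable_on_cmult_right summable_on_subset_banach[OF m]) simp
  then have "\<psi>_term u summable_on - B"
    by (rule summable_on_comparison_test) (use lt \<psi>_term_le_mass \<psi>_term_nonneg in auto)
  then have "\<psi>_term u summable_on (B \<union> - B)"
    by (intro summable_on_union) (simp_all add: B)
  then show ?thesis by simp
qed

lemma \<Psi>_term_summable:
  assumes m: "mass u summable_on UNIV"
  shows "\<Psi>_term u summable_on UNIV"
  by (rule summable_on_comparison_test[OF summable_on_cmult_right[OF \<psi>_term_summable[OF m], of "1 / \<alpha>"]])
    (use \<Psi>_term_le \<Psi>_term_nonneg in auto)

text \<open>On the Nehari set the reaction integral equals the energy, and the Ambrosetti-Rabinowitz condition
bounds the primitive by a fraction \<open>1/\<alpha> < 1/p\<close> of it. So the functional is bounded below there, and a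
bound on the level is a bound on the energy.\<close>

lemma J_lower_bound:
  assumes c: "admissible c" and u: "u \<in> Nehari_V E w \<sigma> p c \<psi>"
  shows "(1 / p - 1 / \<alpha>) * energy c u \<le> J_V E w \<sigma> p c \<psi> u"
proof -
  have m: "mass u summable_on UNIV"
    using u by (intro mass_summable[OF c]) (auto simp: Nehari_V_def energy_space_def)
  have "infsum (\<Psi>_term u) UNIV \<le> infsum (\<lambda>x. 1 / \<alpha> * \<psi>_term u x) UNIV"
    by (rule infsum_mono[OF \<Psi>_term_summable[OF m] summable_on_cmult_right[OF \<psi>_term_summable[OF m]]])
      (use \<Psi>_term_le in auto)
  also have "\<dots> = 1 / \<alpha> * infsum (\<psi>_term u) UNIV"
    by (rule infsum_cmult_right')
  also have "infsum (\<psi>_term u) UNIV = energy c u"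
    using u energy_norm_powr[of c u] admissible_nonneg[OF c]
    by (auto simp: Nehari_V_def vintegral_def)
  finally show ?thesis
    using energy_norm_powr[of c u] admissible_nonneg[OF c]
    by (simp add: J_V_def vintegral_def algebra_simps)
qed

section \<open>Comparison with the Dirichlet problem\<close>

lemma W01p_energy_support:
  assumes "v \<in> W01p \<Omega>" "x \<notin> vclosure E \<Omega>"
  shows "energy_density E w \<sigma> p c v x = 0"
  using assms grad_eq_0_off_vclosure[OF assms]
  by (auto simp: energy_density_def W01p_def vclosure_def)

lemma W01p_in_energy_space:
  assumes v: "v \<in> W01p \<Omega>"
  shows "v \<in> energy_space E w \<sigma> p c"
proof -
  have "(\<lambda>x. \<sigma> x * energy_density E w \<sigma> p c v x) summable_on UNIV \<longleftrightarrow>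
      (\<lambda>x. \<sigma> x * energy_density E w \<sigma> p c v x) summable_on vclosure E \<Omega>"
    by (rule summable_on_cong_neutral) (use W01p_energy_support[OF v] in auto)
  then have "vintegrable \<sigma> UNIV (energy_density E w \<sigma> p c v)"
    by (simp add: vintegrable_def finite_vclosure finite_\<Omega>)
  moreover have "v \<in> C_c"
    unfolding C_c_def using v by (auto simp: W01p_def intro: finite_subset[OF _ finite_\<Omega>])
  moreover have "energy_norm E w \<sigma> p c (\<lambda>x. v x - v x) = 0"
    by (simp add: energy_norm_def vintegral_def energy_density_def)
  ultimately show ?thesis
    unfolding energy_space_def by (auto intro!: exI[of _ "\<lambda>_. v"])
qed

text \<open>The \<open>p\<close>-th power of the Dirichlet norm. The closure of the well is finite, so it is a finite sum and
passes to pointwise limits.\<close>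

definition Dirichlet_energy :: "('v \<Rightarrow> real) \<Rightarrow> real" where
  "Dirichlet_energy v =
     (\<Sum>x\<in>vclosure E \<Omega>. \<sigma> x * grad v x powr p) + (\<Sum>x\<in>\<Omega>. \<sigma> x * (b x * \<bar>v x\<bar> powr p))"

lemma Dirichlet_norm_powr: "Dirichlet_norm E w \<sigma> p b \<Omega> v powr p = Dirichlet_energy v"
proof -
  have "0 \<le> Dirichlet_energy v"
    unfolding Dirichlet_energy_def
    by (intro add_nonneg_nonneg sum_nonneg mult_nonneg_nonneg less_imp_le[OF \<sigma>_pos])
      (auto simp: b_nonneg)
  then show ?thesis
    using powr_inverse_exponent
    by (simp add: Dirichlet_norm_def vintegral_def Dirichlet_energy_def finite_vclosure finite_\<Omega>)
qed

lemma energy_W01p: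
  assumes v: "v \<in> W01p \<Omega>" and c: "\<And>x. x \<in> \<Omega> \<Longrightarrow> c x = b x"
  shows "energy c v = Dirichlet_energy v"
proof -
  let ?K = "vclosure E \<Omega>"
  have "energy c v = (\<Sum>\<^sub>\<infinity>x\<in>?K. \<sigma> x * energy_density E w \<sigma> p c v x)"
    unfolding vintegral_def
    by (rule infsum_cong_neutral) (use W01p_energy_support[OF v] in auto)
  also have "\<dots> = (\<Sum>x\<in>?K. \<sigma> x * grad v x powr p) + (\<Sum>x\<in>?K. \<sigma> x * (c x * \<bar>v x\<bar> powr p))"
    by (simp add: finite_vclosure finite_\<Omega> energy_density_def algebra_simps sum.distrib)
  also have "(\<Sum>x\<in>?K. \<sigma> x * (c x * \<bar>v x\<bar> powr p)) = (\<Sum>x\<in>\<Omega>. \<sigma> x * (b x * \<bar>v x\<bar> powr p))"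
    by (rule sum.mono_neutral_cong_right)
      (use v c finite_vclosure[OF finite_\<Omega>] in \<open>auto simp: W01p_def vclosure_def\<close>)
  finally show ?thesis by (simp add: Dirichlet_energy_def)
qed

lemma vintegral_W01p:
  assumes v: "v \<in> W01p \<Omega>" and F: "\<And>x. F x 0 = 0"
  shows "vintegral \<sigma> UNIV (\<lambda>x. F x (pos_part (v x))) = (\<Sum>x\<in>\<Omega>. \<sigma> x * F x (pos_part (v x)))"
    "vintegral \<sigma> \<Omega> (\<lambda>x. F x (pos_part (v x))) = (\<Sum>x\<in>\<Omega>. \<sigma> x * F x (pos_part (v x)))"
proof -
  show "vintegral \<sigma> \<Omega> (\<lambda>x. F x (pos_part (v x))) = (\<Sum>x\<in>\<Omega>. \<sigma> x * F x (pos_part (v x)))"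
    by (simp add: vintegral_def finite_\<Omega>)
  moreover have "vintegral \<sigma> UNIV (\<lambda>x. F x (pos_part (v x))) = vintegral \<sigma> \<Omega> (\<lambda>x. F x (pos_part (v x)))"
    unfolding vintegral_def
    by (rule infsum_cong_neutral) (use v F in \<open>auto simp: W01p_def\<close>)
  ultimately show "vintegral \<sigma> UNIV (\<lambda>x. F x (pos_part (v x))) = (\<Sum>x\<in>\<Omega>. \<sigma> x * F x (pos_part (v x)))"
    by simp
qed

lemma Nehari_Dirichlet_iff:
  "v \<in> Nehari_Dirichlet E w \<sigma> p b \<Omega> \<psi> \<longleftrightarrow>
     v \<in> W01p \<Omega> \<and> v \<noteq> (\<lambda>_. 0) \<and> Dirichlet_energy v = sum (\<psi>_term v) \<Omega>"
  unfolding Nehari_Dirichlet_def Dirichlet_norm_powr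
  using vintegral_W01p(2)[of v "\<lambda>x s. \<psi> x s * s"] by auto

lemma J_Dirichlet_eq:
  "J_Dirichlet E w \<sigma> p b \<Omega> \<psi> v = 1 / p * Dirichlet_energy v - sum (\<Psi>_term v) \<Omega>"
  unfolding J_Dirichlet_def Dirichlet_norm_powr
  by (simp add: vintegral_def finite_\<Omega>)

text \<open>The potential \<open>a\<close> vanishes on the well, so a function supported there has the same energy for every
\<open>t\<close>. Hence the Dirichlet Nehari set lies in the one on \<open>V\<close>, with equal functionals, which bounds all
the ground state levels on \<open>V\<close> by values of the Dirichlet functional.\<close>

lemma ground_level_V_le:
  assumes t: "1 \<le> t" and v: "v \<in> Nehari_Dirichlet E w \<sigma> p b \<Omega> \<psi>"
  shows "ground_level_V E w \<sigma> p (\<lambda>x. t * a x + b x) \<psi> \<le> J_Dirichlet E w \<sigma> p b \<Omega> \<psi> v"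
proof -
  let ?c = "\<lambda>x. t * a x + b x"
  have c: "admissible ?c" by (rule admissible_deep_well[OF t])
  have vW: "v \<in> W01p \<Omega>" using v by (simp add: Nehari_Dirichlet_iff)
  have e: "energy_norm E w \<sigma> p ?c v powr p = Dirichlet_energy v"
    using energy_norm_powr[of ?c v] admissible_nonneg[OF c] energy_W01p[OF vW, of ?c] a_zero by simp
  have "v \<in> Nehari_V E w \<sigma> p ?c \<psi>"
    unfolding Nehari_V_def
    using v W01p_in_energy_space[OF vW] vintegral_W01p(1)[OF vW, of "\<lambda>x s. \<psi> x s * s"] e
    by (simp add: Nehari_Dirichlet_iff)
  moreover have "0 \<le> J_V E w \<sigma> p ?c \<psi> u" if "u \<in> Nehari_V E w \<sigma> p ?c \<psi>" for u
  proof -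
    have "0 \<le> (1 / p - 1 / \<alpha>) * energy ?c u"
      using p \<alpha> energy_nonneg[of ?c u] admissible_nonneg[OF c]
      by (intro mult_nonneg_nonneg) (auto simp: field_simps)
    then show ?thesis using J_lower_bound[OF c that] by linarith
  qed
  ultimately have "ground_level_V E w \<sigma> p ?c \<psi> \<le> J_V E w \<sigma> p ?c \<psi> v"
    unfolding ground_level_V_def by (intro cINF_lower bdd_belowI[of _ 0]) auto
  also have "J_V E w \<sigma> p ?c \<psi> v = J_Dirichlet E w \<sigma> p b \<Omega> \<psi> v"
    using vintegral_W01p(1)[OF vW, of "Primitive \<psi>"] e by (simp add: J_V_def J_Dirichlet_eq)
  finally show ?thesis .
qed

section \<open>Nonemptiness of the Dirichlet Nehari set\<close>

lemma Primitive_has_derivative: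
  assumes "0 < s"
  shows "(Primitive \<psi> x has_real_derivative \<psi> x s) (at s)"
proof -
  have "continuous_on {0..s + 1} (\<psi> x)"
    by (rule continuous_on_subset[OF \<psi>_cont]) auto
  then have "((\<lambda>r. integral {0..r} (\<psi> x)) has_real_derivative \<psi> x s) (at s within {0..s + 1})"
    by (rule integral_has_real_derivative) (use assms in auto)
  moreover have "at s within {0..s + 1} = at s"
    by (rule at_within_interior) (use assms in auto)
  ultimately show ?thesis by (simp add: Primitive_def[abs_def])
qed

lemma Primitive_continuous: "continuous_on {0..} (Primitive \<psi> x)"
proof -
  have "continuous (at s within {0..}) (Primitive \<psi> x)" if "0 \<le> s" for s
  proof -
    have "continuous_on {0..s + 1} (Primitive \<psi> x)"
      unfolding Primitive_def
      by (intro indefinite_integral_continuous_1 integrable_continuous_real continuous_on_subset[OF \<psi>_cont]) auto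
    then have "continuous (at s within {0..s + 1}) (Primitive \<psi> x)"
      using that by (simp add: continuous_on_eq_continuous_within)
    moreover have "at s within {0..s + 1} = at s within {0..}"
      by (rule at_within_nhd[of _ "{..<s + 1}"]) auto
    ultimately show ?thesis by simp
  qed
  then show ?thesis by (simp add: continuous_on_eq_continuous_within)
qed

text \<open>The condition \<open>\<alpha> \<Psi> \<le> s \<psi>\<close> says that \<open>\<Psi>(s) s\<^sup>-\<^sup>\<alpha>\<close> has a nonnegative derivative.\<close>

lemma Primitive_growth:
  assumes "1 \<le> s"
  shows "Primitive \<psi> x 1 * s powr \<alpha> \<le> Primitive \<psi> x s"
proof -
  define h where "h r = Primitive \<psi> x r * r powr (- \<alpha>)" for r
  have "h 1 \<le> h s"
  proof (rule DERIV_nonneg_imp_nondecreasing[OF assms])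
    fix r :: real assume "1 \<le> r" "r \<le> s"
    then have r: "0 < r" by simp
    have "(h has_real_derivative
        \<psi> x r * r powr (- \<alpha>) + (- \<alpha> * r powr (- \<alpha> - 1)) * Primitive \<psi> x r) (at r)"
      unfolding h_def
      by (rule DERIV_mult[OF Primitive_has_derivative[OF r] has_real_derivative_powr[OF r]])
    moreover have "\<psi> x r * r powr (- \<alpha>) + (- \<alpha> * r powr (- \<alpha> - 1)) * Primitive \<psi> x r =
        r powr (- \<alpha> - 1) * (r * \<psi> x r - \<alpha> * Primitive \<psi> x r)"
      using r by (simp add: powr_diff field_simps)
    moreover have "0 \<le> r powr (- \<alpha> - 1) * (r * \<psi> x r - \<alpha> * Primitive \<psi> x r)"
      using AR[OF r] by (intro mult_nonneg_nonneg) auto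
    ultimately show "\<exists>y. (h has_real_derivative y) (at r) \<and> 0 \<le> y" by auto
  qed
  then show ?thesis using assms by (simp add: h_def powr_minus field_simps)
qed

text \<open>The quotient \<open>\<psi>(s)/s\<^sup>p\<^sup>-\<^sup>1\<close> is at most \<open>\<tau>\<close> near \<open>0\<close>, while the superlinear growth of the primitive makes it
tend to infinity; the intermediate value theorem gives everything above \<open>\<tau>\<close>.\<close>

lemma \<psi>_quotient_attains:
  assumes R: "\<tau> < R"
  shows "\<exists>t>0. \<psi> x t = R * t powr (p - 1)"
proof -
  define q where "q s = \<psi> x s / s powr (p - 1)" for s
  define C where "C = \<alpha> * Primitive \<psi> x 1"
  have C: "0 < C" unfolding C_def by (rule \<Psi>_pos) simp
  \<comment> \<open>Chosen so that \<open>C S\<^sup>\<alpha>\<^sup>-\<^sup>p \<ge> R\<close>; the term \<open>\<delta> / 2\<close> keeps the interval for the intermediate value theorem nonempty.\<close>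
  define S where "S = max 1 (max (\<delta> / 2) ((R / C) powr (1 / (\<alpha> - p))))"
  have S: "1 \<le> S" "\<delta> / 2 \<le> S" by (auto simp: S_def)
  have "R / C = ((R / C) powr (1 / (\<alpha> - p))) powr (\<alpha> - p)"
    using R \<tau>_pos C \<alpha> by (simp add: powr_powr)
  also have "\<dots> \<le> S powr (\<alpha> - p)"
    by (rule powr_mono2) (use \<alpha> in \<open>auto simp: S_def\<close>)
  finally have "R \<le> C * S powr (\<alpha> - p)" using C by (simp add: field_simps)
  also have "\<dots> = C * S powr \<alpha> / S powr p"
    using S by (simp add: powr_diff)
  also have "\<dots> \<le> S * \<psi> x S / S powr p"
  proof (rule divide_right_mono)
    have "C * S powr \<alpha> \<le> \<alpha> * Primitive \<psi> x S"
      unfolding C_def using Primitive_growth[OF S(1), of x] \<alpha>_pos by (simp add: mult.assoc)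
    then show "C * S powr \<alpha> \<le> S * \<psi> x S" using AR[of S x] S by linarith
  qed simp
  also have "\<dots> = q S" using S by (simp add: q_def powr_diff field_simps)
  finally have hi: "R \<le> q S" .
  have "\<psi> x (\<delta> / 2) \<le> \<tau> * (\<delta> / 2) powr (p - 1)" using \<delta> by (intro \<psi>_small) auto
  then have "q (\<delta> / 2) \<le> \<tau>" using \<delta> by (simp add: q_def pos_divide_le_eq)
  then have lo: "q (\<delta> / 2) \<le> R" using R by simp
  have "continuous_on {\<delta> / 2..S} q"
    unfolding q_def
    by (intro continuous_intros continuous_on_subset[OF \<psi>_cont]) (use \<delta> in auto)
  from IVT'[OF lo hi S(2) this] obtain t where "\<delta> / 2 \<le> t" "q t = R" by auto
  moreover from this have "0 < t" using \<delta> by linarith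
  ultimately show ?thesis by (intro exI[of _ t]) (auto simp: q_def field_simps)
qed

lemma grad_scale: "grad (\<lambda>y. t * u y) x = \<bar>t\<bar> * grad u x"
proof -
  have "(\<Sum>y\<in>nbrs x. w x y * (t * u y - t * u x)\<^sup>2) = t\<^sup>2 * (\<Sum>y\<in>nbrs x. w x y * (u y - u x)\<^sup>2)"
    by (simp add: sum_distrib_left power_mult_distrib mult_ac flip: right_diff_distrib)
  then have "grad (\<lambda>y. t * u y) x = sqrt (t\<^sup>2 * (1 / (2 * \<sigma> x) * (\<Sum>y\<in>nbrs x. w x y * (u y - u x)\<^sup>2)))"
    by (simp add: grad_len_def)
  also have "\<dots> = \<bar>t\<bar> * grad u x"
    unfolding grad_len_def by (subst real_sqrt_mult) simp
  finally show ?thesis .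
qed

text \<open>A multiple \<open>t e\<close> of the indicator \<open>e\<close> of one vertex \<open>x0\<close> of the well satisfies the Nehari constraint
exactly when \<open>\<psi>(x0,t)/t\<^sup>p\<^sup>-\<^sup>1\<close> equals the Rayleigh quotient of \<open>e\<close>. That quotient is at least \<open>\<lambda>\<^sub>a\<^sub>,\<^sub>b > \<tau>\<close>, so the
value is attained.\<close>

lemma Nehari_Dirichlet_nonempty: "Nehari_Dirichlet E w \<sigma> p b \<Omega> \<psi> \<noteq> {}"
proof -
  obtain x0 where x0: "x0 \<in> \<Omega>" using \<Omega>_ne by auto
  define e where "e x = (if x = x0 then 1 else 0 :: real)" for x
  have eW: "e \<in> W01p \<Omega>" using x0 by (auto simp: W01p_def e_def)
  have e_ne: "e \<noteq> (\<lambda>_. 0)" by (auto simp: e_def fun_eq_iff)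
  have "infsum (mass e) UNIV = infsum (mass e) {x0}"
    by (rule infsum_cong_neutral) (auto simp: e_def)
  then have "infsum (mass e) UNIV = \<sigma> x0" by (simp add: e_def)
  then have "lambda_ab E w \<sigma> p a b * \<sigma> x0 \<le> Dirichlet_energy e"
    using lambda_times_mass_le_energy[OF W01p_in_energy_space[OF eW] e_ne]
      energy_W01p[OF eW, of "\<lambda>x. a x + b x"] a_zero by simp
  moreover have "\<tau> * \<sigma> x0 < lambda_ab E w \<sigma> p a b * \<sigma> x0"
    using \<tau> \<sigma>_pos by (rule mult_strict_right_mono)
  ultimately have "\<tau> * \<sigma> x0 < Dirichlet_energy e" by linarith
  then have "\<tau> < Dirichlet_energy e / \<sigma> x0"
    using \<sigma>_pos[of x0] by (simp add: pos_less_divide_eq)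
  from \<psi>_quotient_attains[OF this, of x0] obtain t
    where t: "0 < t" "\<psi> x0 t = Dirichlet_energy e / \<sigma> x0 * t powr (p - 1)" by auto
  let ?v = "\<lambda>x. t * e x"
  have vW: "?v \<in> W01p \<Omega>" using eW by (auto simp: W01p_def)
  have "Dirichlet_energy ?v = t powr p * Dirichlet_energy e"
    using t(1)
    by (simp add: Dirichlet_energy_def grad_scale abs_mult powr_mult distrib_left sum_distrib_left mult_ac)
  also have "\<dots> = \<sigma> x0 * (\<psi> x0 t * t)"
    using t \<sigma>_pos[of x0] by (simp add: powr_diff field_simps)
  also have "\<dots> = sum (\<psi>_term ?v) \<Omega>"
  proof -
    have "sum (\<psi>_term ?v) \<Omega> = sum (\<psi>_term ?v) {x0}"
      by (rule sum.mono_neutral_right) (use x0 finite_\<Omega> in \<open>auto simp: e_def\<close>)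
    then show ?thesis using t(1) by (simp add: e_def)
  qed
  finally have "?v \<in> Nehari_Dirichlet E w \<sigma> p b \<Omega> \<psi>"
    using vW e_ne t(1) by (auto simp: Nehari_Dirichlet_iff fun_eq_iff)
  then show ?thesis by auto
qed

end

section \<open>Bounds and compactness for ground states in deepening wells\<close>

locale deep_well_sequence = nehari_problem E w \<sigma> \<sigma>\<^sub>0 p a b \<Omega> \<psi> \<alpha> \<tau> \<delta>
  for E :: "'v rel" and w :: "'v \<Rightarrow> 'v \<Rightarrow> real" and \<sigma> :: "'v \<Rightarrow> real" and \<sigma>\<^sub>0 p :: real
    and a b :: "'v \<Rightarrow> real" and \<Omega> :: "'v set"
    and \<psi> :: "'v \<Rightarrow> real \<Rightarrow> real" and \<alpha> \<tau> \<delta> :: real +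
  fixes \<theta> :: "nat \<Rightarrow> real" and u :: "nat \<Rightarrow> 'v \<Rightarrow> real"
  assumes \<theta>_ge_1: "\<And>k. 1 \<le> \<theta> k" and \<theta>_at_top: "filterlim \<theta> at_top sequentially"
    and u_space: "\<And>k. u k \<in> energy_space E w \<sigma> p (\<lambda>x. a x + b x)"
    and u_ground: "\<And>k. positive_ground_state_V E w \<sigma> p (\<lambda>x. \<theta> k * a x + b x) \<psi> (u k)"
begin

abbreviation pot :: "nat \<Rightarrow> 'v \<Rightarrow> real" where
  "pot k \<equiv> \<lambda>x. \<theta> k * a x + b x"

lemma pot_admissible: "admissible (pot k)"
  by (rule admissible_deep_well[OF \<theta>_ge_1])

lemma pot_nonneg: "0 \<le> pot k x"
  by (rule admissible_nonneg[OF pot_admissible])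

lemma u_pos: "0 < u k x"
  using u_ground[of k] by (simp add: positive_ground_state_V_def)

lemma u_ne: "u k \<noteq> (\<lambda>_. 0)"
  using u_pos by (metis less_irrefl)

lemma u_Nehari: "u k \<in> Nehari_V E w \<sigma> p (pot k) \<psi>"
  using u_ground[of k] by (simp add: positive_ground_state_V_def)

lemma u_integrable: "vintegrable \<sigma> UNIV (energy_density E w \<sigma> p (pot k) (u k))"
  using u_Nehari[of k] by (simp add: Nehari_V_def energy_space_def)

lemma mass_u_summable: "mass (u k) summable_on UNIV"
  by (rule mass_summable[OF pot_admissible u_integrable])

lemma mass_nonneg: "0 \<le> mass f x"
  by (intro mult_nonneg_nonneg less_imp_le[OF \<sigma>_pos]) simp

lemma energy_eq_reaction: "energy (pot k) (u k) = infsum (\<psi>_term (u k)) UNIV"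
  using u_Nehari[of k] energy_norm_powr[of "pot k" "u k"] pot_nonneg
  by (simp add: Nehari_V_def vintegral_def)

lemma energy_term_nonneg: "0 \<le> \<sigma> x * energy_density E w \<sigma> p (pot k) (u k) x"
  by (intro mult_nonneg_nonneg less_imp_le[OF \<sigma>_pos] energy_density_nonneg pot_nonneg)

lemma J_le_Dirichlet:
  assumes "f \<in> Nehari_Dirichlet E w \<sigma> p b \<Omega> \<psi>"
  shows "J_V E w \<sigma> p (pot k) \<psi> (u k) \<le> J_Dirichlet E w \<sigma> p b \<Omega> \<psi> f"
  using u_ground[of k] ground_level_V_le[OF \<theta>_ge_1 assms, of k]
  by (simp add: positive_ground_state_V_def)

text \<open>Any element of the Dirichlet Nehari set bounds all levels, and the levels bound the energies.\<close>

lemma energy_bounded: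
  obtains C where "0 < C" "\<And>k. energy (pot k) (u k) \<le> C"
proof -
  obtain f where f: "f \<in> Nehari_Dirichlet E w \<sigma> p b \<Omega> \<psi>"
    using Nehari_Dirichlet_nonempty by auto
  define d where "d = 1 / p - 1 / \<alpha>"
  have d: "0 < d" using p \<alpha> by (simp add: d_def field_simps)
  define C where "C = \<bar>J_Dirichlet E w \<sigma> p b \<Omega> \<psi> f\<bar> / d + 1"
  have C: "energy (pot k) (u k) \<le> C" for k
  proof -
    have "d * energy (pot k) (u k) \<le> \<bar>J_Dirichlet E w \<sigma> p b \<Omega> \<psi> f\<bar>"
      using J_lower_bound[OF pot_admissible u_Nehari, of k] J_le_Dirichlet[OF f, of k]
      unfolding d_def by linarith
    then have "energy (pot k) (u k) \<le> \<bar>J_Dirichlet E w \<sigma> p b \<Omega> \<psi> f\<bar> / d"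
      using d by (simp add: field_simps)
    then show ?thesis by (simp add: C_def)
  qed
  have "0 < C" unfolding C_def using d by (intro add_nonneg_pos) auto
  then show ?thesis using C that by blast
qed

text \<open>Because \<open>\<theta>\<^sub>k \<ge> 1\<close>, the bound with \<open>\<lambda>\<^sub>a\<^sub>,\<^sub>b\<close> transfers to the energy of the problem with index \<open>k\<close>.\<close>

lemma energy_ab_le: "energy (\<lambda>x. a x + b x) (u k) \<le> energy (pot k) (u k)"
  unfolding vintegral_def
proof (rule infsum_mono)
  show "(\<lambda>x. \<sigma> x * energy_density E w \<sigma> p (\<lambda>x. a x + b x) (u k) x) summable_on UNIV"
    using u_space[of k] by (simp add: energy_space_def vintegrable_def)
  show "(\<lambda>x. \<sigma> x * energy_density E w \<sigma> p (pot k) (u k) x) summable_on UNIV"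
    using u_integrable[of k] by (simp add: vintegrable_def)
  fix x
  have "1 * a x \<le> \<theta> k * a x" using \<theta>_ge_1 a_nonneg by (rule mult_right_mono)
  then show "\<sigma> x * energy_density E w \<sigma> p (\<lambda>x. a x + b x) (u k) x
      \<le> \<sigma> x * energy_density E w \<sigma> p (pot k) (u k) x"
    unfolding energy_density_def
    by (intro mult_left_mono add_left_mono mult_right_mono add_right_mono less_imp_le[OF \<sigma>_pos]) auto
qed

lemma lambda_mass_le_energy:
  "lambda_ab E w \<sigma> p a b * infsum (mass (u k)) UNIV \<le> energy (pot k) (u k)"
  using lambda_times_mass_le_energy[OF u_space u_ne, of k] energy_ab_le[of k] by linarith

lemma u_bounded:
  obtains B where "\<And>k x. \<bar>u k x\<bar> \<le> B"
proof -
  obtain C where C: "0 < C" "\<And>k. energy (pot k) (u k) \<le> C" by (rule energy_bounded) blast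
  have "\<bar>u k x\<bar> \<le> (C / (\<tau> * \<sigma>\<^sub>0)) powr (1 / p)" for k x
  proof -
    have "\<tau> * (\<sigma>\<^sub>0 * \<bar>u k x\<bar> powr p) \<le> \<tau> * mass (u k) x"
      using \<tau>_pos \<sigma>_ge[of x] by (intro mult_left_mono mult_right_mono) auto
    also have "mass (u k) x \<le> infsum (mass (u k)) UNIV"
      using finite_sum_le_infsum[OF mass_u_summable, of "{x}" k] mass_nonneg by simp
    also have "\<tau> * infsum (mass (u k)) UNIV \<le> lambda_ab E w \<sigma> p a b * infsum (mass (u k)) UNIV"
      using \<tau> by (intro mult_right_mono infsum_nonneg mass_nonneg) auto
    also have "\<dots> \<le> C" using lambda_mass_le_energy[of k] C(2)[of k] by linarith
    finally have "\<bar>u k x\<bar> powr p \<le> C / (\<tau> * \<sigma>\<^sub>0)"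
      using \<tau>_pos \<sigma>\<^sub>0_pos by (simp add: field_simps)
    then have "(\<bar>u k x\<bar> powr p) powr (1 / p) \<le> (C / (\<tau> * \<sigma>\<^sub>0)) powr (1 / p)"
      using p by (intro powr_mono2) auto
    then show ?thesis using p by (simp add: powr_powr)
  qed
  then show ?thesis using that by blast
qed

text \<open>Off the well the potential is at least \<open>\<theta>\<^sub>k\<close>, so a bounded energy leaves mass at most \<open>C / \<theta>\<^sub>k\<close> there. This
is what expels the ground states from \<open>V - \<Omega>\<close>.\<close>

lemma mass_off_tendsto_0: "(\<lambda>k. infsum (mass (u k)) (- \<Omega>)) \<longlonglongrightarrow> 0"
proof -
  obtain C where C: "0 < C" "\<And>k. energy (pot k) (u k) \<le> C" by (rule energy_bounded) blast
  have le: "infsum (mass (u k)) (- \<Omega>) \<le> C / \<theta> k" for k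
  proof -
    let ?e = "\<lambda>x. \<sigma> x * energy_density E w \<sigma> p (pot k) (u k) x"
    have "\<theta> k * infsum (mass (u k)) (- \<Omega>) = infsum (\<lambda>x. \<theta> k * mass (u k) x) (- \<Omega>)"
      by (rule infsum_cmult_right'[symmetric])
    also have "\<dots> \<le> infsum ?e UNIV"
    proof (rule infsum_mono_neutral)
      show "(\<lambda>x. \<theta> k * mass (u k) x) summable_on - \<Omega>"
        by (intro summable_on_cmult_right summable_on_subset_banach[OF mass_u_summable]) simp
      show "?e summable_on UNIV" using u_integrable[of k] by (simp add: vintegrable_def)
      show "0 \<le> ?e x" for x by (rule energy_term_nonneg)
      fix x assume x: "x \<in> - \<Omega> \<inter> UNIV"
      have "\<theta> k * 1 \<le> \<theta> k * a x"
        using x a_ge_1[of x] \<theta>_ge_1[of k] by (intro mult_left_mono) auto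
      then have "\<theta> k \<le> pot k x" using b_nonneg[of x] by simp
      then have "\<theta> k * \<bar>u k x\<bar> powr p \<le> pot k x * \<bar>u k x\<bar> powr p"
        by (rule mult_right_mono) simp
      then have "\<theta> k * \<bar>u k x\<bar> powr p \<le> energy_density E w \<sigma> p (pot k) (u k) x"
        unfolding energy_density_def by (rule add_increasing[rotated]) simp
      then have "\<sigma> x * (\<theta> k * \<bar>u k x\<bar> powr p) \<le> ?e x"
        by (intro mult_left_mono less_imp_le[OF \<sigma>_pos])
      then show "\<theta> k * mass (u k) x \<le> ?e x" by (simp add: mult_ac)
    qed simp
    also have "\<dots> \<le> C" using C(2)[of k] by (simp add: vintegral_def)
    finally show ?thesis using \<theta>_ge_1[of k] by (simp add: field_simps)
  qed
  show ?thesis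
  proof (rule tendsto_sandwich[OF _ _ tendsto_const])
    show "(\<lambda>k. C / \<theta> k) \<longlonglongrightarrow> 0"
      by (rule tendsto_divide_0[OF tendsto_const filterlim_at_top_imp_at_infinity[OF \<theta>_at_top]])
  qed (use le in \<open>auto intro!: always_eventually infsum_nonneg mass_nonneg\<close>)
qed

lemma eventually_small_off:
  assumes e: "0 < \<epsilon>"
  shows "\<forall>\<^sub>F k in sequentially. \<forall>x. x \<notin> \<Omega> \<longrightarrow> u k x < \<epsilon>"
proof -
  have "\<forall>\<^sub>F k in sequentially. infsum (mass (u k)) (- \<Omega>) < \<sigma>\<^sub>0 * \<epsilon> powr p"
    using mass_off_tendsto_0 by (rule order_tendstoD) (use e \<sigma>\<^sub>0_pos in auto)
  then show ?thesis
  proof (rule eventually_mono, intro allI impI)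
    fix k x assume lt: "infsum (mass (u k)) (- \<Omega>) < \<sigma>\<^sub>0 * \<epsilon> powr p" and x: "x \<notin> \<Omega>"
    have "mass (u k) x \<le> infsum (mass (u k)) (- \<Omega>)"
      using finite_sum_le_infsum[OF summable_on_subset_banach[OF mass_u_summable subset_UNIV], of "{x}" "- \<Omega>" k]
        x mass_nonneg by simp
    then have lt': "mass (u k) x < \<sigma>\<^sub>0 * \<epsilon> powr p" using lt by linarith
    show "u k x < \<epsilon>"
    proof (rule ccontr)
      assume "\<not> u k x < \<epsilon>"
      then have "\<sigma>\<^sub>0 * \<epsilon> powr p \<le> mass (u k) x"
        using \<sigma>\<^sub>0_pos \<sigma>_ge[of x] e p by (intro mult_mono powr_mono2) auto
      then show False using lt' by linarith
    qed
  qed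
qed

lemma u_tendsto_0_off:
  assumes "x \<notin> \<Omega>"
  shows "(\<lambda>k. u k x) \<longlonglongrightarrow> 0"
proof (rule tendstoI)
  fix e :: real assume "0 < e"
  from eventually_small_off[OF this] show "\<forall>\<^sub>F k in sequentially. dist (u k x) 0 < e"
    by (rule eventually_mono) (use assms u_pos in \<open>auto simp: abs_of_pos\<close>)
qed

text \<open>Off the well the whole sequence tends to \<open>0\<close>, so only the finitely many vertices of \<open>\<Omega>\<close> require a
choice of subsequence.\<close>

lemma pointwise_convergent_subsequence:
  obtains r v where "strict_mono (r :: nat \<Rightarrow> nat)" "\<And>x. (\<lambda>k. u (r k) x) \<longlonglongrightarrow> v x"
proof -
  obtain B where B: "\<And>k x. \<bar>u k x\<bar> \<le> B" by (rule u_bounded) blast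
  obtain r :: "nat \<Rightarrow> nat" where r: "strict_mono r" "\<forall>x\<in>\<Omega>. convergent (\<lambda>k. u (r k) x)"
    using finite_pointwise_subsequence[OF finite_\<Omega>, of u "\<lambda>_. B"] B by auto
  have "(\<lambda>k. u (r k) x) \<longlonglongrightarrow> (if x \<in> \<Omega> then lim (\<lambda>k. u (r k) x) else 0)" for x
  proof (cases "x \<in> \<Omega>")
    case True
    then show ?thesis using r(2) by (simp add: convergent_LIMSEQ_iff)
  next
    case False
    then show ?thesis
      using LIMSEQ_subseq_LIMSEQ[OF u_tendsto_0_off r(1), of x] by (simp add: o_def)
  qed
  with r(1) show ?thesis by (rule that)
qed

lemma deep_well_subsequence:
  assumes "strict_mono (r :: nat \<Rightarrow> nat)"
  shows "deep_well_sequence E w \<sigma> \<sigma>\<^sub>0 p a b \<Omega> \<psi> \<alpha> \<tau> \<delta> (\<lambda>k. \<theta> (r k)) (\<lambda>k. u (r k))"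
  by unfold_locales
    (use \<theta>_ge_1 u_space u_ground filterlim_compose[OF \<theta>_at_top filterlim_subseq[OF assms]] in auto)

end

section \<open>The limit is a Dirichlet ground state\<close>

locale convergent_deep_well_sequence =
  deep_well_sequence E w \<sigma> \<sigma>\<^sub>0 p a b \<Omega> \<psi> \<alpha> \<tau> \<delta> \<theta> u
  for E :: "'v rel" and w :: "'v \<Rightarrow> 'v \<Rightarrow> real" and \<sigma> :: "'v \<Rightarrow> real" and \<sigma>\<^sub>0 p :: real
    and a b :: "'v \<Rightarrow> real" and \<Omega> :: "'v set"
    and \<psi> :: "'v \<Rightarrow> real \<Rightarrow> real" and \<alpha> \<tau> \<delta> :: real
    and \<theta> :: "nat \<Rightarrow> real" and u :: "nat \<Rightarrow> 'v \<Rightarrow> real" +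
  fixes v :: "'v \<Rightarrow> real"
  assumes u_lim: "\<And>x. (\<lambda>k. u k x) \<longlonglongrightarrow> v x"
begin

lemma v_nonneg: "0 \<le> v x"
  by (rule LIMSEQ_le_const[OF u_lim]) (use u_pos less_imp_le in blast)

lemma v_off: "x \<notin> \<Omega> \<Longrightarrow> v x = 0"
  using LIMSEQ_unique[OF u_lim u_tendsto_0_off] .

lemma v_W01p: "v \<in> W01p \<Omega>"
  by (simp add: W01p_def v_off)

text \<open>The reaction integrals converge because the well is finite and the contribution outside it is
eventually at most a multiple of the mass there. It serves both for \<open>\<psi>(x,s) s\<close> and for the primitive.\<close>

lemma reaction_tendsto:
  assumes cont: "\<And>x. continuous_on {0..} (F x)" and K: "0 \<le> K"
    and nn: "\<And>f x. 0 \<le> \<sigma> x * F x (pos_part (f x))"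
    and le: "\<And>f x. \<sigma> x * F x (pos_part (f x)) \<le> K * \<psi>_term f x"
  shows "(\<lambda>k. \<Sum>\<^sub>\<infinity>x. \<sigma> x * F x (pos_part (u k x))) \<longlonglongrightarrow> (\<Sum>x\<in>\<Omega>. \<sigma> x * F x (pos_part (v x)))"
proof -
  let ?f = "\<lambda>k x. \<sigma> x * F x (pos_part (u k x))"
  have sm: "?f k summable_on UNIV" for k
    by (rule summable_on_comparison_test[where f = "\<lambda>x. K * \<psi>_term (u k) x"])
      (intro summable_on_cmult_right \<psi>_term_summable mass_u_summable le nn)+
  have "(\<lambda>k. F x (pos_part (u k x))) \<longlonglongrightarrow> F x (pos_part (v x))" for x
    by (rule continuous_on_tendsto_compose[OF cont]) (auto intro!: tendsto_max u_lim)
  then have on: "(\<lambda>k. sum (?f k) \<Omega>) \<longlonglongrightarrow> (\<Sum>x\<in>\<Omega>. \<sigma> x * F x (pos_part (v x)))"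
    by (intro tendsto_intros)
  have off: "(\<lambda>k. infsum (?f k) (- \<Omega>)) \<longlonglongrightarrow> 0"
  proof (rule tendsto_sandwich[OF _ _ tendsto_const])
    show "(\<lambda>k. K * \<tau> * infsum (mass (u k)) (- \<Omega>)) \<longlonglongrightarrow> 0"
      using tendsto_mult_right_zero[OF mass_off_tendsto_0] by simp
    show "\<forall>\<^sub>F k in sequentially. infsum (?f k) (- \<Omega>) \<le> K * \<tau> * infsum (mass (u k)) (- \<Omega>)"
      using eventually_small_off[OF \<delta>]
    proof (rule eventually_mono)
      fix k assume small: "\<forall>x. x \<notin> \<Omega> \<longrightarrow> u k x < \<delta>"
      have "infsum (?f k) (- \<Omega>) \<le> infsum (\<lambda>x. K * \<tau> * mass (u k) x) (- \<Omega>)"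
      proof (rule infsum_mono)
        show "?f k summable_on - \<Omega>" by (rule summable_on_subset_banach[OF sm]) simp
        show "(\<lambda>x. K * \<tau> * mass (u k) x) summable_on - \<Omega>"
          by (intro summable_on_cmult_right summable_on_subset_banach[OF mass_u_summable]) simp
        fix x assume "x \<in> - \<Omega>"
        then have "K * \<psi>_term (u k) x \<le> K * (\<tau> * mass (u k) x)"
          using small K by (intro mult_left_mono \<psi>_term_le_mass) auto
        then show "?f k x \<le> K * \<tau> * mass (u k) x" using le[of x "u k"] by (simp only: mult.assoc)
      qed
      then show "infsum (?f k) (- \<Omega>) \<le> K * \<tau> * infsum (mass (u k)) (- \<Omega>)"
        by (simp only: infsum_cmult_right')
    qed
  qed (auto intro!: always_eventually infsum_nonneg nn)
  have "(\<lambda>k. sum (?f k) \<Omega> + infsum (?f k) (- \<Omega>)) \<longlonglongrightarrow> (\<Sum>x\<in>\<Omega>. \<sigma> x * F x (pos_part (v x))) + 0"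
    by (intro tendsto_add on off)
  then show ?thesis
    using infsum_split_compl[OF sm, of _ \<Omega>] by (simp add: finite_\<Omega>)
qed

lemma \<psi>_term_tendsto: "(\<lambda>k. infsum (\<psi>_term (u k)) UNIV) \<longlonglongrightarrow> sum (\<psi>_term v) \<Omega>"
  by (rule reaction_tendsto[where F = "\<lambda>x s. \<psi> x s * s" and K = 1])
    (use \<psi>_term_nonneg in \<open>auto intro!: continuous_intros \<psi>_cont\<close>)

lemma \<Psi>_term_tendsto: "(\<lambda>k. infsum (\<Psi>_term (u k)) UNIV) \<longlonglongrightarrow> sum (\<Psi>_term v) \<Omega>"
  by (rule reaction_tendsto[where F = "Primitive \<psi>" and K = "1 / \<alpha>"])
    (use \<Psi>_term_nonneg \<Psi>_term_le \<alpha>_pos Primitive_continuous in auto)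

lemma v_equation:
  assumes x: "x \<in> \<Omega>"
  shows "- p_laplacian E w \<sigma> p v x + b x * (\<bar>v x\<bar> powr (p - 2) * v x) = \<psi> x (pos_part (v x))"
proof (rule LIMSEQ_unique)
  have "(\<lambda>k. \<bar>u k x\<bar> powr (p - 2) * u k x) \<longlonglongrightarrow> \<bar>v x\<bar> powr (p - 2) * v x"
    by (rule tendsto_powr_times[where C = 1]) (use p in \<open>auto intro!: tendsto_intros u_lim\<close>)
  then show "(\<lambda>k. - p_laplacian E w \<sigma> p (u k) x + b x * (\<bar>u k x\<bar> powr (p - 2) * u k x))
      \<longlonglongrightarrow> - p_laplacian E w \<sigma> p v x + b x * (\<bar>v x\<bar> powr (p - 2) * v x)"
    by (rule tendsto_add[OF tendsto_minus[OF tendsto_p_laplacian[OF p u_lim]] tendsto_mult[OF tendsto_const]])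
  have eq: "- p_laplacian E w \<sigma> p (u k) x + b x * (\<bar>u k x\<bar> powr (p - 2) * u k x)
      = \<psi> x (pos_part (u k x))" for k
  proof -
    have "- p_laplacian E w \<sigma> p (u k) x + pot k x * (\<bar>u k x\<bar> powr (p - 2) * u k x)
        = \<psi> x (pos_part (u k x))"
      using u_ground[of k] unfolding positive_ground_state_V_def by blast
    then show ?thesis by (simp only: a_zero[OF x] mult_zero_right add_0)
  qed
  show "(\<lambda>k. - p_laplacian E w \<sigma> p (u k) x + b x * (\<bar>u k x\<bar> powr (p - 2) * u k x))
      \<longlonglongrightarrow> \<psi> x (pos_part (v x))"
    unfolding eq by (rule continuous_on_tendsto_compose[OF \<psi>_cont]) (auto intro!: tendsto_max u_lim)
qed

text \<open>The limit satisfies the Nehari constraint with equality, and not just with the inequality that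
lower semicontinuity of the norm would give: it solves the equation on the well, and testing the
equation with the limit itself is Green's formula.\<close>

lemma v_Nehari_identity: "Dirichlet_energy v = sum (\<psi>_term v) \<Omega>"
proof -
  have pt: "\<psi>_term v x = \<sigma> x * (v x * - p_laplacian E w \<sigma> p v x) + \<sigma> x * (b x * \<bar>v x\<bar> powr p)"
    if "x \<in> \<Omega>" for x
  proof -
    have "\<bar>v x\<bar> powr (p - 2) * v x * v x = \<bar>v x\<bar> powr p"
      using v_nonneg[of x] by (cases "v x = 0") (auto simp: powr_diff powr_numeral power2_eq_square)
    moreover have "\<psi>_term v x = \<sigma> x * ((- p_laplacian E w \<sigma> p v x + b x * (\<bar>v x\<bar> powr (p - 2) * v x)) * v x)"
      using v_equation[OF that] v_nonneg[of x] by (simp add: max_def)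
    ultimately show ?thesis by (simp add: algebra_simps)
  qed
  show ?thesis
    unfolding Dirichlet_energy_def
    by (simp only: sum.cong[OF refl pt] sum.distrib Green_finite_support[OF p finite_\<Omega> v_W01p])
qed

text \<open>If the limit vanished, \<open>u\<^sub>k\<close> would eventually be below \<open>\<delta>\<close> everywhere; its reaction integral, which equals
its energy, would then be at most \<open>\<tau>\<close> times its mass, against the Rayleigh quotient bound.\<close>

lemma v_nonzero: "v \<noteq> (\<lambda>_. 0)"
proof
  assume v: "v = (\<lambda>_. 0)"
  have "\<forall>\<^sub>F k in sequentially. \<forall>x\<in>\<Omega>. u k x < \<delta>"
    using order_tendstoD(2)[OF u_lim, of _ \<delta>] \<delta> v finite_\<Omega> by (simp add: eventually_ball_finite)
  with eventually_small_off[OF \<delta>] have "\<forall>\<^sub>F k in sequentially. \<forall>x. u k x < \<delta>"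
    by eventually_elim auto
  then obtain k where small: "\<And>x. u k x < \<delta>"
    using eventually_happens by force
  let ?m = "infsum (mass (u k)) UNIV"
  obtain x where "0 < mass (u k) x" using u_pos \<sigma>_pos by (metis abs_of_pos mult_pos_pos powr_gt_zero less_irrefl)
  also have "mass (u k) x \<le> ?m"
    using finite_sum_le_infsum[OF mass_u_summable, of "{x}" k] mass_nonneg by simp
  finally have "\<tau> * ?m < lambda_ab E w \<sigma> p a b * ?m"
    using \<tau> by (intro mult_strict_right_mono)
  also have "\<dots> \<le> infsum (\<psi>_term (u k)) UNIV"
    using lambda_mass_le_energy[of k] by (simp add: energy_eq_reaction)
  also have "\<dots> \<le> infsum (\<lambda>x. \<tau> * mass (u k) x) UNIV"
    by (rule infsum_mono[OF \<psi>_term_summable[OF mass_u_summable] summable_on_cmult_right[OF mass_u_summable]])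
      (use small \<psi>_term_le_mass in auto)
  also have "\<dots> = \<tau> * ?m" by (rule infsum_cmult_right')
  finally show False by simp
qed

lemma v_Nehari: "v \<in> Nehari_Dirichlet E w \<sigma> p b \<Omega> \<psi>"
  using v_W01p v_nonzero v_Nehari_identity by (simp add: Nehari_Dirichlet_iff)

text \<open>No energy is lost in the limit, since on both sides the energy equals the reaction integral. This is
the reason why the convergence is strong.\<close>

lemma energy_tendsto: "(\<lambda>k. energy (pot k) (u k)) \<longlonglongrightarrow> Dirichlet_energy v"
  using \<psi>_term_tendsto by (simp only: energy_eq_reaction v_Nehari_identity)

text \<open>The values \<open>J\<^sub>k(u\<^sub>k)\<close> converge to the Dirichlet functional of the limit, and each of them lies below
every value on the Dirichlet Nehari set.\<close>

lemma v_minimizes: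
  assumes f: "f \<in> Nehari_Dirichlet E w \<sigma> p b \<Omega> \<psi>"
  shows "J_Dirichlet E w \<sigma> p b \<Omega> \<psi> v \<le> J_Dirichlet E w \<sigma> p b \<Omega> \<psi> f"
proof (rule LIMSEQ_le_const2)
  have "J_V E w \<sigma> p (pot k) \<psi> (u k) = 1 / p * energy (pot k) (u k) - infsum (\<Psi>_term (u k)) UNIV" for k
    using energy_norm_powr[of "pot k" "u k"] pot_nonneg by (simp add: J_V_def vintegral_def)
  then show "(\<lambda>k. J_V E w \<sigma> p (pot k) \<psi> (u k)) \<longlonglongrightarrow> J_Dirichlet E w \<sigma> p b \<Omega> \<psi> v"
    unfolding J_Dirichlet_eq
    by (simp only:) (intro tendsto_intros energy_tendsto \<Psi>_term_tendsto)
  show "\<exists>N. \<forall>n\<ge>N. J_V E w \<sigma> p (pot n) \<psi> (u n) \<le> J_Dirichlet E w \<sigma> p b \<Omega> \<psi> f"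
    using J_le_Dirichlet[OF f] by blast
qed

lemma v_positive_ground_state:
  assumes conn: "graph_connected_on \<Omega> E"
  shows "positive_ground_state_Dirichlet E w \<sigma> p b \<Omega> \<psi> v"
  unfolding positive_ground_state_Dirichlet_def
proof (intro conjI ballI)
  show "v \<in> Nehari_Dirichlet E w \<sigma> p b \<Omega> \<psi>" by (rule v_Nehari)
  show "J_Dirichlet E w \<sigma> p b \<Omega> \<psi> v = ground_level_Dirichlet E w \<sigma> p b \<Omega> \<psi>"
    unfolding ground_level_Dirichlet_def
    by (rule cInf_eq_minimum[symmetric]) (use v_Nehari v_minimizes in auto)
  show "v x = 0" if "x \<in> vboundary E \<Omega>" for x
    using that by (intro v_off) (simp add: vboundary_def)
  fix x assume x: "x \<in> \<Omega>"
  show "- p_laplacian E w \<sigma> p v x + b x * (\<bar>v x\<bar> powr (p - 2) * v x) = \<psi> x (pos_part (v x))"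
    by (rule v_equation[OF x])
  obtain z where z: "v z \<noteq> 0" using v_nonzero by auto
  show "0 < v x"
  proof (rule strong_maximum_principle[where A = \<Omega> and v = v and z = z and p = p])
    show "graph_connected_on \<Omega> E" "0 \<le> v y" "v z \<noteq> 0" "x \<in> \<Omega>" for y
      by (fact conn v_nonneg z x)+
    show "p_laplacian E w \<sigma> p v y = 0" if "y \<in> \<Omega>" "v y = 0" for y
      using v_equation[OF that(1)] that(2) by (simp add: \<psi>_0)
    show "z \<in> \<Omega>" using z v_off by blast
  qed
qed

section \<open>Convergence of the gradients\<close>

abbreviation W1p_term :: "('v \<Rightarrow> real) \<Rightarrow> 'v \<Rightarrow> real" where
  "W1p_term f x \<equiv> \<sigma> x * energy_density E w \<sigma> p (\<lambda>_. 1) f x"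

lemma W1p_term_nonneg: "0 \<le> W1p_term f x"
  by (intro mult_nonneg_nonneg less_imp_le[OF \<sigma>_pos] energy_density_nonneg) simp

lemma W1p_term_u_le:
  "W1p_term (u k) x \<le> \<sigma> x * energy_density E w \<sigma> p (pot k) (u k) x + mass (u k) x"
proof -
  have "grad (u k) x powr p \<le> energy_density E w \<sigma> p (pot k) (u k) x"
    unfolding energy_density_def using pot_nonneg[of k x] by simp
  then have "\<sigma> x * grad (u k) x powr p \<le> \<sigma> x * energy_density E w \<sigma> p (pot k) (u k) x"
    by (intro mult_left_mono less_imp_le[OF \<sigma>_pos])
  then show ?thesis by (simp add: energy_density_def[of _ _ _ _ "\<lambda>_. 1"] distrib_left)
qed

lemma energy_terms_summable: "(\<lambda>x. \<sigma> x * energy_density E w \<sigma> p (pot k) (u k) x) summable_on UNIV"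
  using u_integrable[of k] by (simp add: vintegrable_def)

lemma W1p_term_u_summable: "W1p_term (u k) summable_on UNIV"
  by (rule summable_on_comparison_test
      [OF summable_on_add[OF energy_terms_summable mass_u_summable] W1p_term_u_le W1p_term_nonneg])

lemma W1p_term_diff_off:
  assumes "x \<notin> vclosure E \<Omega>"
  shows "W1p_term (\<lambda>y. u k y - v y) x = W1p_term (u k) x"
proof -
  have "v x = 0" using assms by (intro v_off) (auto simp: vclosure_def)
  moreover have "v y = 0" if "(x, y) \<in> E" for y
    by (rule v_off) (use assms that E_sym in \<open>auto simp: vclosure_def vboundary_def\<close>)
  ultimately have "grad (\<lambda>y. u k y - v y) x = grad (u k) x"
    by (intro grad_cong) auto
  with \<open>v x = 0\<close> show ?thesis by (simp add: energy_density_def)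
qed

text \<open>The gradient of \<open>u\<^sub>k\<close> is not controlled by its values, because the vertex degrees and weights may be
unbounded. Instead the tail is obtained by subtraction: the total energies tend to the Dirichlet
energy of the limit, and the part carried by the finite closure of the well already accounts for all
of it in the limit.\<close>

lemma W1p_tail_tendsto_0:
  "(\<lambda>k. infsum (W1p_term (u k)) (- vclosure E \<Omega>)) \<longlonglongrightarrow> 0"
proof -
  let ?K = "vclosure E \<Omega>"
  let ?e = "\<lambda>k x. \<sigma> x * energy_density E w \<sigma> p (pot k) (u k) x"
  let ?d = "\<lambda>f x. \<sigma> x * (grad f x powr p + b x * \<bar>f x\<bar> powr p)"
  have K: "finite ?K" by (rule finite_vclosure[OF finite_\<Omega>])
  have "sum (?d v) ?K = Dirichlet_energy v"
  proof -
    have "sum (?d v) ?K = energy b v"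
      unfolding vintegral_def
      by (subst infsum_cong_neutral[where T = ?K and g = "?d v"])
        (use W01p_energy_support[OF v_W01p, of _ b] K in \<open>auto simp: energy_density_def\<close>)
    then show ?thesis using energy_W01p[OF v_W01p, of b] by simp
  qed
  moreover have "(\<lambda>k. sum (?d (u k)) ?K) \<longlonglongrightarrow> sum (?d v) ?K"
    by (intro tendsto_intros tendsto_powr' tendsto_grad u_lim)
      (use p in \<open>auto intro!: always_eventually\<close>)
  ultimately have "(\<lambda>k. energy (pot k) (u k) - sum (?d (u k)) ?K + infsum (mass (u k)) (- \<Omega>))
      \<longlonglongrightarrow> Dirichlet_energy v - Dirichlet_energy v + 0"
    by (intro tendsto_intros energy_tendsto mass_off_tendsto_0) simp
  then have lim: "(\<lambda>k. energy (pot k) (u k) - sum (?d (u k)) ?K + infsum (mass (u k)) (- \<Omega>)) \<longlonglongrightarrow> 0"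
    by simp
  have le: "infsum (W1p_term (u k)) (- ?K)
      \<le> energy (pot k) (u k) - sum (?d (u k)) ?K + infsum (mass (u k)) (- \<Omega>)" for k
  proof -
    have e_K: "?e k summable_on - ?K" and m_K: "mass (u k) summable_on - ?K"
      by (rule summable_on_subset_banach[OF energy_terms_summable subset_UNIV],
          rule summable_on_subset_banach[OF mass_u_summable subset_UNIV])
    have "infsum (W1p_term (u k)) (- ?K) \<le> infsum (\<lambda>x. ?e k x + mass (u k) x) (- ?K)"
      by (rule infsum_mono[OF summable_on_subset_banach[OF W1p_term_u_summable subset_UNIV]
            summable_on_add[OF e_K m_K] W1p_term_u_le])
    also have "\<dots> = infsum (?e k) (- ?K) + infsum (mass (u k)) (- ?K)"
      by (rule infsum_add[OF e_K m_K])
    finally have 1: "infsum (W1p_term (u k)) (- ?K) \<le> infsum (?e k) (- ?K) + infsum (mass (u k)) (- ?K)" .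
    have 2: "infsum (mass (u k)) (- ?K) \<le> infsum (mass (u k)) (- \<Omega>)"
      by (rule infsum_mono2[OF m_K summable_on_subset_banach[OF mass_u_summable subset_UNIV]])
        (auto simp: vclosure_def mass_nonneg)
    have 3: "energy (pot k) (u k) = sum (?e k) ?K + infsum (?e k) (- ?K)"
      using infsum_split_compl[OF energy_terms_summable, of k ?K] K by (simp add: vintegral_def)
    have 4: "sum (?d (u k)) ?K \<le> sum (?e k) ?K"
    proof (rule sum_mono)
      fix x
      have "0 \<le> \<theta> k * a x" using \<theta>_ge_1[of k] a_nonneg[of x] by simp
      then show "?d (u k) x \<le> ?e k x"
        unfolding energy_density_def
        by (intro mult_left_mono add_left_mono mult_right_mono less_imp_le[OF \<sigma>_pos]) auto
    qed
    show ?thesis using 1 2 3 4 by linarith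
  qed
  show ?thesis
    by (rule tendsto_sandwich[OF _ _ tendsto_const lim])
      (use le in \<open>auto intro!: always_eventually infsum_nonneg W1p_term_nonneg\<close>)
qed

text \<open>On the finite closure of the well convergence is pointwise; off it, neither a vertex nor any of its
neighbours sees the limit, so the difference has the same density as \<open>u\<^sub>k\<close> and the tail estimate applies.\<close>

lemma u_W1p_converges: "W1p_converges E w \<sigma> p u v"
proof -
  let ?K = "vclosure E \<Omega>"
  let ?z = "\<lambda>k y. u k y - v y"
  have K: "finite ?K" by (rule finite_vclosure[OF finite_\<Omega>])
  have "W1p_term (?z k) summable_on - ?K" for k
    using summable_on_cong[of "- ?K" "W1p_term (?z k)" "W1p_term (u k)"] W1p_term_diff_off
      summable_on_subset_banach[OF W1p_term_u_summable subset_UNIV, of k "- ?K"] by simp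
  then have "W1p_term (?z k) summable_on (?K \<union> - ?K)" for k
    by (intro summable_on_union) (simp_all add: K)
  then have sm: "W1p_term (?z k) summable_on UNIV" for k by simp
  have "infsum (W1p_term (?z k)) (- ?K) = infsum (W1p_term (u k)) (- ?K)" for k
    by (rule infsum_cong) (rule W1p_term_diff_off, simp)
  then have split: "infsum (W1p_term (?z k)) UNIV = sum (W1p_term (?z k)) ?K + infsum (W1p_term (u k)) (- ?K)" for k
    using infsum_split_compl[OF sm, of k ?K] K by simp
  have z_lim: "(\<lambda>k. ?z k y) \<longlonglongrightarrow> 0" for y
    using tendsto_diff[OF u_lim tendsto_const, of y "v y"] by simp
  have "(\<lambda>k. sum (W1p_term (?z k)) ?K) \<longlonglongrightarrow> (\<Sum>x\<in>?K. \<sigma> x * (grad (\<lambda>_. 0) x powr p + 1 * \<bar>0\<bar> powr p))"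
    unfolding energy_density_def
    by (intro tendsto_intros tendsto_powr' tendsto_grad z_lim)
      (use p in \<open>auto intro!: always_eventually\<close>)
  then have "(\<lambda>k. sum (W1p_term (?z k)) ?K) \<longlonglongrightarrow> 0" by simp
  from tendsto_add[OF this W1p_tail_tendsto_0]
  have "(\<lambda>k. infsum (W1p_term (?z k)) UNIV) \<longlonglongrightarrow> 0" by (simp add: split)
  then have "(\<lambda>k. infsum (W1p_term (?z k)) UNIV powr (1 / p)) \<longlonglongrightarrow> 0 powr (1 / p)"
    by (rule tendsto_powr'[OF _ tendsto_const])
      (use p in \<open>auto intro!: always_eventually infsum_nonneg W1p_term_nonneg\<close>)
  then have "(\<lambda>k. W1p_norm E w \<sigma> p (?z k)) \<longlonglongrightarrow> 0"
    by (simp add: W1p_norm_def energy_norm_def vintegral_def)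
  moreover have "v \<in> W1p E w \<sigma> p"
    using W01p_in_energy_space[OF v_W01p] by (simp add: energy_space_def W1p_def)
  moreover have "u k \<in> W1p E w \<sigma> p" for k
    using W1p_term_u_summable by (simp add: W1p_def vintegrable_def)
  ultimately show ?thesis by (simp add: W1p_converges_def)
qed

end

section \<open>Convergence of ground states to a Dirichlet ground state\<close>

theorem theorem1p3:
  fixes E :: "'v rel" and w :: "'v \<Rightarrow> 'v \<Rightarrow> real" and \<sigma> :: "'v \<Rightarrow> real" and \<sigma>\<^sub>0 p :: real
    and vO :: 'v and a b :: "'v \<Rightarrow> real" and \<Omega> :: "'v set"
    and \<psi> :: "'v \<Rightarrow> real \<Rightarrow> real" and \<theta> :: "nat \<Rightarrow> real" and u :: "nat \<Rightarrow> 'v \<Rightarrow> real"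
  assumes graph: "weighted_graph E w" "locally_finite E" "graph_connected_on UNIV E"
    and measure: "\<sigma>\<^sub>0 > 0" "\<And>x. \<sigma> x \<ge> \<sigma>\<^sub>0"
    and p: "p > 1"
    and nonneg: "\<And>x. a x \<ge> 0" "\<And>x. b x \<ge> 0"
    and Omega: "\<Omega> = {x. a x = 0}" "\<Omega> \<noteq> {}" "graph_connected_on \<Omega> E" "finite \<Omega>"
    and a_ge_1: "\<And>x. x \<notin> \<Omega> \<Longrightarrow> a x \<ge> 1"
    and a_infinity: "filterlim a at_top (filtercomap (\<lambda>x. graph_dist E x vO) at_top)"
    and i: "\<And>x. \<psi> x 0 = 0" "\<And>x. continuous_on {0..} (\<psi> x)"
           "\<And>M. M > 0 \<Longrightarrow> \<exists>A. \<forall>x. \<forall>s\<in>{0..M}. \<psi> x s \<le> A"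
    and ii: "\<exists>\<alpha>>p. \<forall>s>0. \<forall>x. 0 < \<alpha> * Primitive \<psi> x s \<and> \<alpha> * Primitive \<psi> x s \<le> s * \<psi> x s"
    and iii: "\<exists>\<tau> < lambda_ab E w \<sigma> p a b. \<exists>\<delta>>0.
                \<forall>x s. 0 < s \<and> s < \<delta> \<longrightarrow> \<psi> x s \<le> \<tau> * s powr (p - 1)"
    and iv: "\<And>x. strict_mono_on {0<..} (\<lambda>s. \<psi> x s / s powr (p - 1))"
    and theta: "\<And>k. \<theta> k \<ge> 1" "filterlim \<theta> at_top sequentially"
    and u_space: "\<And>k. u k \<in> energy_space E w \<sigma> p (\<lambda>x. a x + b x)"
    and u_ground: "\<And>k. positive_ground_state_V E w \<sigma> p (\<lambda>x. \<theta> k * a x + b x) \<psi> (u k)"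
  shows "\<exists>r :: nat \<Rightarrow> nat. strict_mono r \<and>
           (\<exists>u\<^sub>0. W1p_converges E w \<sigma> p (\<lambda>k. u (r k)) u\<^sub>0 \<and>
                 (\<forall>x. x \<notin> \<Omega> \<longrightarrow> u\<^sub>0 x = 0) \<and>
                 positive_ground_state_Dirichlet E w \<sigma> p b \<Omega> \<psi> u\<^sub>0)"
proof -
  obtain \<alpha> where \<alpha>: "p < \<alpha>" "\<And>x s. 0 < s \<Longrightarrow> 0 < \<alpha> * Primitive \<psi> x s"
      "\<And>x s. 0 < s \<Longrightarrow> \<alpha> * Primitive \<psi> x s \<le> s * \<psi> x s"
    using ii by blast
  obtain \<tau> \<delta> where \<tau>: "\<tau> < lambda_ab E w \<sigma> p a b" "0 < \<delta>"
      "\<And>x s. 0 < s \<Longrightarrow> s < \<delta> \<Longrightarrow> \<psi> x s \<le> \<tau> * s powr (p - 1)"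
    using iii by blast
  interpret deep_well_sequence E w \<sigma> \<sigma>\<^sub>0 p a b \<Omega> \<psi> \<alpha> \<tau> \<delta> \<theta> u
    by unfold_locales (fact graph measure p nonneg Omega a_ge_1 i \<alpha> \<tau> theta u_space u_ground | simp add: Omega(1))+
  obtain r v where r: "strict_mono r" and lim: "\<And>x. (\<lambda>k. u (r k) x) \<longlonglongrightarrow> v x"
    using pointwise_convergent_subsequence by blast
  interpret limit: deep_well_sequence E w \<sigma> \<sigma>\<^sub>0 p a b \<Omega> \<psi> \<alpha> \<tau> \<delta> "\<lambda>k. \<theta> (r k)" "\<lambda>k. u (r k)"
    by (rule deep_well_subsequence[OF r])
  interpret limit: convergent_deep_well_sequence E w \<sigma> \<sigma>\<^sub>0 p a b \<Omega> \<psi> \<alpha> \<tau> \<delta> "\<lambda>k. \<theta> (r k)" "\<lambda>k. u (r k)" v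
    by unfold_locales (rule lim)
  show ?thesis
    using r limit.u_W1p_converges limit.v_off limit.v_positive_ground_state[OF Omega(3)] by blast
qed

end
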